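(* Let $G$ and $H$ be connected graphs of order $n\ge2$ and $m\ge2$, respectively, each of which is either chordal or a cycle graph. If $G$ is just a frame graph in the spaces of dimension $n',n'+1,\dots,n$ and $H$ is just a frame graph in the spaces of dimension $m',m'+1,\dots,m$, then the corona product $G\circ H$ is just a frame graph in the spaces of dimension $nm'+n',nm'+n'+1,\dots,nm+n-1,nm+n$.
   Context: All graphs are finite and simple. A finite frame for a finite-dimensional inner product space $\mathcal{H}$ over $\mathbb{R}$ or $\mathbb{C}$ is a finite sequence $\varphi=(f_i)_{i=1}^N$ in $\mathcal{H}$ for which there are constants $0<A\le B<\infty$ with $A\|f\|^2\le\sum_{i=1}^N|\langle f,f_i\rangle|^2\le B\|f\|^2$ for all $f\in\mathcal{H}$ (equivalently, a finite sequence spanning $\mathcal{H}$; repeated vectors are allowed and count as different vertices). Its frame graph $G(\varphi)$ has the elements $f_1,\dots,f_N$ of the sequence as vertices, and for $i\ne j$, $f_i$ and $f_j$ are adjacent iff $\langle f_i,f_j\rangle\ne 0$. A graph $G$ is a frame graph in $\mathcal{H}$ if there is a finite frame $\varphi$ for $\mathcal{H}$ with $G(\varphi)=G$ (up to labelling of vertices). "$G$ is just a frame graph in the spaces of dimension $a,a+1,\dots,b$" means: for each $\mathbb{F}\in\{\mathbb{R},\mathbb{C}\}$ and each integer $d\ge1$, $G$ is a frame graph in a $d$-dimensional inner product space over $\mathbb{F}$ if and only if $a\le d\le b$. A graph is chordal if it has no induced cycle $C_r$ with $r\ge4$. The corona product $G_1\circ G_2$ of $G_1=(V_1,E_1)$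 with $G_2=(V_2,E_2)$ is the graph of order $|V_1||V_2|+|V_1|$ obtained by taking one copy of $G_1$ and $|V_1|$ copies of $G_2$, and joining every vertex of the $i$th copy of $G_2$ to the $i$th vertex of $G_1$. *)

theory Defs
  imports
    "HOL-Analysis.Analysis"
    "Graph_Theory.Graph_Theory"
    "Jordan_Normal_Form.Matrix"
begin

text \<open>
  Finite simple graphs are rendered by the locale \<open>pair_graph\<close>: a finite set of vertices and a
  symmetric, loop-free set of arcs, so an edge \<open>{u, v}\<close> is the two arcs \<open>(u, v)\<close> and \<open>(v, u)\<close>.
\<close>

definition cycle_graph :: "nat \<Rightarrow> nat pair_pre_digraph" where
  "cycle_graph r =
    \<lparr> pverts = {..<r},
      parcs = {(i, j). i < r \<and> j < r \<and> (j = Suc i mod r \<or> i = Suc j mod r)} \<rparr>"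

definition is_cycle_graph :: "'v pair_pre_digraph \<Rightarrow> bool" where
  "is_cycle_graph G \<longleftrightarrow>
    (\<exists>r\<ge>3. digraph_iso (with_proj (cycle_graph r)) (with_proj G))"

definition chordal :: "'v pair_pre_digraph \<Rightarrow> bool" where
  "chordal G \<longleftrightarrow>
    \<not> (\<exists>r\<ge>4. \<exists>K :: 'v pair_pre_digraph.
          induced_subgraph (with_proj K) (with_proj G) \<and>
          digraph_iso (with_proj (cycle_graph r)) (with_proj K))"

text \<open>
  In the corona product, \<open>Inl u\<close> is the vertex \<open>u\<close> of the copy of \<open>G\<close>, and \<open>Inr (u, x)\<close> is the
  vertex \<open>x\<close> in the copy of \<open>H\<close> that belongs to \<open>u\<close>.
\<close>

definition corona ::
  "'v pair_pre_digraph \<Rightarrow> 'w pair_pre_digraph \<Rightarrow> ('v + 'v \<times> 'w) pair_pre_digraph" where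
  "corona G H =
    \<lparr> pverts = Inl ` pverts G \<union> Inr ` (pverts G \<times> pverts H),
      parcs = {(Inl u, Inl v) | u v. (u, v) \<in> parcs G}
            \<union> {(Inr (u, x), Inr (u, y)) | u x y. u \<in> pverts G \<and> (x, y) \<in> parcs H}
            \<union> {(Inl u, Inr (u, x)) | u x. u \<in> pverts G \<and> x \<in> pverts H}
            \<union> {(Inr (u, x), Inl u) | u x. u \<in> pverts G \<and> x \<in> pverts H} \<rparr>"

text \<open>
  A \<open>d\<close>-dimensional inner product space over \<open>\<real>\<close> or \<open>\<complex>\<close> is the vector space
  \<^term>\<open>carrier_vec d\<close> with an arbitrary inner product \<open>ip\<close>, linear in the first argument (the choice
  of a basis puts every \<open>d\<close>-dimensional inner product space in this form). The scalars
  \<open>'k\<close> are meant to be \<^typ>\<open>real\<close> or \<^typ>\<open>complex\<close>, where \<^const>\<open>conjugate\<close> is the identity and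
  complex conjugation, respectively.
\<close>

locale inner_product_space =
  fixes d :: nat
    and ip :: "'k :: {conjugatable_field, real_normed_field} vec \<Rightarrow> 'k vec \<Rightarrow> 'k"
  assumes ip_add_left:
      "\<lbrakk>x \<in> carrier_vec d; y \<in> carrier_vec d; z \<in> carrier_vec d\<rbrakk>
        \<Longrightarrow> ip (x + y) z = ip x z + ip y z"
    and ip_smult_left:
      "\<lbrakk>x \<in> carrier_vec d; y \<in> carrier_vec d\<rbrakk> \<Longrightarrow> ip (c \<cdot>\<^sub>v x) y = c * ip x y"
    and ip_conjugate:
      "\<lbrakk>x \<in> carrier_vec d; y \<in> carrier_vec d\<rbrakk> \<Longrightarrow> ip y x = conjugate (ip x y)"
    and ip_pos:
      "\<lbrakk>x \<in> carrier_vec d; x \<noteq> 0\<^sub>v d\<rbrakk> \<Longrightarrow> \<exists>r::real. 0 < r \<and> ip x x = of_real r"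

text \<open>
  The number \<open>ip f f\<close> is a nonnegative real embedded in \<open>'k\<close>, so the squared norm of \<open>f\<close> is
  the real number \<open>norm (ip f f)\<close>.
\<close>

definition finite_frame ::
  "nat \<Rightarrow> ('k :: {conjugatable_field, real_normed_field} vec \<Rightarrow> 'k vec \<Rightarrow> 'k) \<Rightarrow> 'k vec list \<Rightarrow> bool"
where
  "finite_frame d ip fs \<longleftrightarrow>
    set fs \<subseteq> carrier_vec d \<and>
    (\<exists>A B :: real. 0 < A \<and> A \<le> B \<and>
      (\<forall>f \<in> carrier_vec d.
        A * norm (ip f f) \<le> (\<Sum>i<length fs. (norm (ip f (fs ! i)))\<^sup>2) \<and>
        (\<Sum>i<length fs. (norm (ip f (fs ! i)))\<^sup>2) \<le> B * norm (ip f f)))"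

text \<open>
  The vertices of the frame graph are the positions in the sequence, so that repeated vectors
  give different vertices.
\<close>

definition frame_graph ::
  "('k :: zero vec \<Rightarrow> 'k vec \<Rightarrow> 'k) \<Rightarrow> 'k vec list \<Rightarrow> nat pair_pre_digraph" where
  "frame_graph ip fs =
    \<lparr> pverts = {..<length fs},
      parcs = {(i, j). i < length fs \<and> j < length fs \<and> i \<noteq> j \<and> ip (fs ! i) (fs ! j) \<noteq> 0} \<rparr>"

definition is_frame_graph_in_dim ::
  "'k :: {conjugatable_field, real_normed_field} itself \<Rightarrow> nat \<Rightarrow> 'v pair_pre_digraph \<Rightarrow> bool" where
  "is_frame_graph_in_dim (_ :: 'k itself) d G \<longleftrightarrow>
    (\<exists>(ip :: 'k vec \<Rightarrow> 'k vec \<Rightarrow> 'k) fs.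
      inner_product_space d ip \<and> finite_frame d ip fs \<and>
      digraph_iso (with_proj (frame_graph ip fs)) (with_proj G))"

definition just_frame_graph_in_dims :: "'v pair_pre_digraph \<Rightarrow> nat \<Rightarrow> nat \<Rightarrow> bool" where
  "just_frame_graph_in_dims G a b \<longleftrightarrow>
    (\<forall>d\<ge>1. is_frame_graph_in_dim TYPE(real) d G \<longleftrightarrow> a \<le> d \<and> d \<le> b) \<and>
    (\<forall>d\<ge>1. is_frame_graph_in_dim TYPE(complex) d G \<longleftrightarrow> a \<le> d \<and> d \<le> b)"

end

(*
Only the positive semidefinite rank matters: G is a frame graph in dimension d iff some positive
semidefinite matrix with graph G has rank d, and this rank is additive over the corona. In a frame
for the corona, the vectors of the copies of H span mutually orthogonal subspaces, and projecting
the vectors of G onto the orthogonal complement of these subspaces keeps their inner products.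
Conversely, in a direct sum of a space for G and one space for each copy of H, the vector of a
vertex of G gets a component in the space of its copy of H which is not orthogonal to any
vector there; this is possible since H has no isolated vertices, hence no zero vectors.
*)
theory Submission
  imports Defs
begin

subsection \<open>Orthonormal families\<close>

text \<open>A given frame comes with an unknown inner product, while the representations built here
  have arcs, sum types or orthonormal sets as index sets. Sesquilinear forms on coordinate functions
  (\<open>fun_ip\<close>) cover all of these, with scalars in \<open>rc_field\<close>, which
  collects what the real and complex cases share. Rank is measured by the size of an orthonormal
  basis, and the matrix by coordinates against it (\<open>gram_rep\<close>). Projecting onto an
  orthogonal complement then means extending an orthonormal basis and keeping only the new
  coordinates. That a basis lies in the span of the given vectors is expressed by an estimate, which
  yields both the transfer of orthogonality to the basis and the lower frame bound. Additivity gives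
  a full interval because the dimensions for \<open>G\<close> and for the copies of \<open>H\<close>
  vary independently. The interval hypotheses speak of dimensions at least 1 and by their form would
  allow an empty interval; arcs force the spaces to be nonzero and some dimension to occur.\<close>

class rc_field = conjugatable_field + real_normed_field +
  assumes mult_conjugate_scaleR: "x * conjugate x = (norm x)\<^sup>2 *\<^sub>R 1"

instance real :: rc_field
  by intro_classes (simp add: power2_eq_square)

instance complex :: rc_field
  by intro_classes (simp only: conjugate_complex_def complex_norm_square[symmetric]
    scaleR_conv_of_real of_real_power mult_1_right)

lemma mult_conjugate: "x * conjugate x = of_real ((norm (x :: 'k::rc_field))\<^sup>2)"
  by (simp only: mult_conjugate_scaleR of_real_def)

lemma conjugate_of_real [simp]: "conjugate (of_real r :: 'k::rc_field) = of_real r"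
proof (cases "r = 0")
  case False
  have "of_real r * conjugate (of_real r :: 'k) = of_real r * of_real r"
    by (simp only: mult_conjugate norm_of_real power2_abs) (simp add: power2_eq_square)
  with False show ?thesis by simp
qed simp

lemma conjugate_one [simp]: "conjugate (1 :: 'k::rc_field) = 1"
  using conjugate_of_real[of 1] by simp

lemma norm_conjugate [simp]: "norm (conjugate (x :: 'k::rc_field)) = norm x"
proof (cases "x = 0")
  case False
  have "norm x * norm (conjugate x) = norm x * norm x"
    by (simp only: norm_mult[symmetric] mult_conjugate) (simp add: power2_eq_square norm_mult)
  with False show ?thesis by simp
qed simp

lemma sum_mult_conjugate: "(\<Sum>a\<in>A. f a * conjugate (f a :: 'k::rc_field)) = of_real (\<Sum>a\<in>A. (norm (f a))\<^sup>2)"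
  by (simp add: mult_conjugate)

text \<open>Functions on the whole type serve as vectors, so there is no carrier to track;
  \<open>pos\<close> and \<open>null\<close> make the null space of \<open>s\<close> consist exactly
  of the functions that vanish on \<open>B\<close>.\<close>

locale fun_ip =
  fixes B :: "'b set" and s :: "('b \<Rightarrow> 'k::rc_field) \<Rightarrow> ('b \<Rightarrow> 'k) \<Rightarrow> 'k"
  assumes finite_index: "finite B"
    and add_left: "s (\<lambda>b. f b + g b) h = s f h + s g h"
    and scale_left: "s (\<lambda>b. c * f b) h = c * s f h"
    and conjugate_sym: "s g f = conjugate (s f g)"
    and pos: "b \<in> B \<Longrightarrow> f b \<noteq> 0 \<Longrightarrow> \<exists>r>0. s f f = of_real r"
    and null: "(\<And>b. b \<in> B \<Longrightarrow> f b = 0) \<Longrightarrow> s f g = 0"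
begin

lemma zero_left [simp]: "s (\<lambda>b. 0) g = 0"
  by (rule null) simp

lemma eq_zero_sym: "s f g = 0 \<longleftrightarrow> s g f = 0"
  using conjugate_sym[of f g] by simp

lemma sum_left: "finite I \<Longrightarrow> s (\<lambda>b. \<Sum>i\<in>I. c i * f i b) h = (\<Sum>i\<in>I. c i * s (f i) h)"
  by (induction I rule: finite_induct) (simp_all add: add_left scale_left)

lemma diff_sum_left:
  assumes "finite I"
  shows "s (\<lambda>b. f b - (\<Sum>i\<in>I. c i * g i b)) h = s f h - (\<Sum>i\<in>I. c i * s (g i) h)"
proof -
  have "s (\<lambda>b. f b - (\<Sum>i\<in>I. c i * g i b)) h = s (\<lambda>b. f b + (-1) * (\<Sum>i\<in>I. c i * g i b)) h"
    by simp
  also have "\<dots> = s f h - (\<Sum>i\<in>I. c i * s (g i) h)"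
    by (simp only: add_left scale_left sum_left[OF assms]) simp
  finally show ?thesis .
qed

lemma scale_right: "s f (\<lambda>b. c * g b) = conjugate c * s f g"
  by (subst conjugate_sym) (simp add: scale_left conjugate_dist_mul conjugate_sym[of f g])

lemma self_eq_zeroD:
  assumes "s f f = 0" "b \<in> B"
  shows "f b = 0"
  using pos[of b f] assms by force

lemma self_eq_zeroD_left:
  assumes "s f f = 0"
  shows "s f g = 0"
  using self_eq_zeroD[OF assms] by (rule null)

lemma self_pos:
  assumes "s f f \<noteq> 0"
  obtains r where "r > 0" "s f f = of_real r"
proof -
  obtain b where "b \<in> B" "f b \<noteq> 0"
    using null[of f f] assms by blast
  from pos[of b f, OF this] that show thesis by blast
qed

definition orthonormal :: "('b \<Rightarrow> 'k) set \<Rightarrow> bool" where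
  "orthonormal E \<longleftrightarrow> finite E \<and> (\<forall>e\<in>E. \<forall>e'\<in>E. s e e' = (if e = e' then 1 else 0))"

text \<open>This expresses membership in the span of the orthonormal set, up to the null space of
  \<open>s\<close>: the values outside \<open>B\<close> are irrelevant for \<open>s\<close>.\<close>

definition parseval :: "('b \<Rightarrow> 'k) set \<Rightarrow> ('b \<Rightarrow> 'k) \<Rightarrow> bool" where
  "parseval E f \<longleftrightarrow> (\<forall>x. s f x = (\<Sum>e\<in>E. s f e * conjugate (s x e)))"

lemma parsevalD: "parseval E f \<Longrightarrow> s f x = (\<Sum>e\<in>E. s f e * conjugate (s x e))"
  unfolding parseval_def by (drule spec[of _ x])

lemma orthonormal_finite: "orthonormal E \<Longrightarrow> finite E"
  by (simp add: orthonormal_def)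

lemma orthonormal_empty [simp]: "orthonormal {}"
  by (simp add: orthonormal_def)

lemma sum_orthonormal:
  assumes "orthonormal E" "e \<in> E"
  shows "(\<Sum>e'\<in>E. c e' * s e' e) = c e"
proof -
  have "(\<Sum>e'\<in>E. c e' * s e' e) = (\<Sum>e'\<in>E. if e' = e then c e' else 0)"
    using assms by (intro sum.cong) (auto simp: orthonormal_def)
  with assms show ?thesis by (simp add: orthonormal_finite)
qed

text \<open>A vector expanded in \<open>E\<close> is orthogonal to every further member of
  \<open>E'\<close>, so the extra terms vanish.\<close>

lemma parseval_mono:
  assumes "parseval E f" "E \<subseteq> E'" "orthonormal E'"
  shows "parseval E' f"
  unfolding parseval_def
proof
  fix x
  have E': "finite E'" using assms(3) by (rule orthonormal_finite)
  have "s f e = 0" if e: "e \<in> E' - E" for e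
  proof -
    have "s f e = (\<Sum>e'\<in>E. s f e' * conjugate (s e e'))"
      using assms(1) by (rule parsevalD)
    also have "\<dots> = 0"
    proof (intro sum.neutral ballI)
      fix e' assume "e' \<in> E"
      with e assms(2) have "e \<in> E'" "e' \<in> E'" "e \<noteq> e'" by auto
      with assms(3) have "s e e' = 0" by (simp add: orthonormal_def)
      then show "s f e' * conjugate (s e e') = 0" by simp
    qed
    finally show ?thesis .
  qed
  then have "(\<Sum>e\<in>E'. s f e * conjugate (s x e)) = (\<Sum>e\<in>E. s f e * conjugate (s x e))"
    using assms(2) E' by (intro sum.mono_neutral_right) auto
  then show "s f x = (\<Sum>e\<in>E'. s f e * conjugate (s x e))"
    using parsevalD[OF assms(1)] by (rule trans[OF _ sym, rotated])
qed

text \<open>The estimate in the last conjunct replaces membership of \<open>E\<close> in the span of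
  \<open>E0\<close> and \<open>F\<close>: it makes every vector orthogonal to both sets orthogonal
  to \<open>E\<close>, and its constant later enters the lower frame bound.\<close>

lemma gram_schmidt:
  assumes "finite F" and E0: "orthonormal E0"
  shows "\<exists>E. E0 \<inter> E = {} \<and> orthonormal (E0 \<union> E) \<and> card E \<le> card F \<and>
    (\<forall>f\<in>F. parseval (E0 \<union> E) f) \<and>
    (\<exists>C\<ge>0. \<forall>e\<in>E. \<forall>x. norm (s x e) \<le> C * (\<Sum>f\<in>E0 \<union> F. norm (s x f)))"
  using assms(1)
proof (induction F rule: finite_induct)
  case empty
  show ?case using E0 by (intro exI[of _ "{}"]) auto
next
  case (insert f F)
  then obtain E C where E: "E0 \<inter> E = {}" "orthonormal (E0 \<union> E)" "card E \<le> card F"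
      "\<And>f. f \<in> F \<Longrightarrow> parseval (E0 \<union> E) f" "C \<ge> 0"
      "\<And>e x. e \<in> E \<Longrightarrow> norm (s x e) \<le> C * (\<Sum>f\<in>E0 \<union> F. norm (s x f))"
    by blast
  let ?D = "E0 \<union> E"
  let ?S = "\<lambda>x. \<Sum>f\<in>E0 \<union> F. norm (s x f)" and ?S' = "\<lambda>x. \<Sum>g\<in>E0 \<union> insert f F. norm (s x g)"
  have fin: "finite ?D" "finite E0" "finite E" using orthonormal_finite[OF E(2)] by auto
  have S: "?S x \<le> ?S' x" for x
    using fin \<open>finite F\<close> by (intro sum_mono2) auto
  have S_ge: "norm (s x g) \<le> ?S' x" if "g \<in> E0 \<union> insert f F" for x g
    using fin \<open>finite F\<close> that by (intro member_le_sum) auto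
  have S0: "?S' x \<ge> 0" for x by (intro sum_nonneg) auto
  have bound: "norm (s x e) \<le> C * ?S' x" if "e \<in> E" for x e
    using E(6)[OF that, of x] mult_left_mono[OF S E(5), of x] by linarith
  \<comment> \<open>Residual of \<open>f\<close> after projection onto the span of
    \<open>?D\<close>; if it is null, \<open>f\<close> needs no new basis vector.\<close>
  define r where "r = (\<lambda>b. f b - (\<Sum>e\<in>?D. s f e * e b))"
  have sr: "s r x = s f x - (\<Sum>e\<in>?D. s f e * s e x)" for x
    unfolding r_def by (rule diff_sum_left) (rule fin)
  have r_orth: "s r e = 0" if "e \<in> ?D" for e
    unfolding sr using sum_orthonormal[OF E(2) that] by simp
  show ?case
  proof (cases "s r r = 0")
    case True
    have "parseval ?D f"
      unfolding parseval_def
    proof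
      fix x
      show "s f x = (\<Sum>e\<in>?D. s f e * conjugate (s x e))"
        using self_eq_zeroD_left[OF True, of x] unfolding sr by (simp flip: conjugate_sym)
    qed
    moreover have "card E \<le> card (insert f F)"
      using E(3) card_insert_le[of F f] by linarith
    ultimately show ?thesis
      using E(1,2,4,5) bound by (intro exI[of _ E] conjI exI[of _ C]) auto
  next
    case False
    then obtain q where q: "q > 0" "s r r = of_real q" by (rule self_pos)
    define k where "k = (of_real (1 / sqrt q) :: 'k)"
    define e' where "e' = (\<lambda>b. k * r b)"
    have k0: "k \<noteq> 0" using q by (simp add: k_def)
    have kk: "k * k * of_real q = 1"
      using q by (simp add: k_def of_real_mult[symmetric] del: of_real_mult of_real_divide)
    have ck: "conjugate k = k" by (simp only: k_def conjugate_of_real)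
    have e'e': "s e' e' = 1"
      unfolding e'_def using q kk by (simp add: scale_left scale_right ck mult.assoc)
    have e'e: "s e' e = 0" "s e e' = 0" if "e \<in> ?D" for e
      using r_orth[OF that] eq_zero_sym[of e' e] by (simp_all add: e'_def scale_left)
    then have e'_notin: "e' \<notin> ?D" using e'e' by auto
    have on: "orthonormal (insert e' ?D)"
      using E(2) e'e e'e' by (auto simp: orthonormal_def)
    have D': "E0 \<union> insert e' E = insert e' ?D" by auto
    have fr: "s f x = s r x + (\<Sum>e\<in>?D. s f e * s e x)" for x
      by (simp add: sr)
    \<comment> \<open>The component of \<open>f\<close> along \<open>e'\<close> is
      \<open>1 / k\<close>, so the new term \<open>s f e' * s e' x\<close> of the expansion equals
      \<open>s r x\<close>, which is what was missing.\<close>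
    have sfe': "k * s f e' = 1"
    proof -
      have "(\<Sum>e\<in>?D. s f e * s e e') = 0" using e'e by (intro sum.neutral) auto
      then have "s f e' = s r e'" using fr[of e'] by simp
      also have "\<dots> = k * of_real q" by (simp add: e'_def scale_right ck q)
      finally show ?thesis using kk by (simp add: mult.assoc)
    qed
    have "parseval (insert e' ?D) f"
      unfolding parseval_def
    proof
      fix x
      have "s f e' * conjugate (s x e') = s f e' * s e' x"
        by (simp add: conjugate_sym[of e' x])
      also have "\<dots> = s r x"
        using sfe' by (simp add: e'_def scale_left mult.assoc[symmetric] mult.commute)
      finally show "s f x = (\<Sum>e\<in>insert e' ?D. s f e * conjugate (s x e))"
        using fin e'_notin fr[of x] by (simp add: conjugate_sym[symmetric])
    qed
    moreover have "parseval (insert e' ?D) g" if "g \<in> F" for g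
      using parseval_mono[OF E(4)[OF that] _ on] by auto
    moreover have "card (insert e' E) \<le> card (insert f F)"
      using E(3) insert.hyps fin by (auto simp: card_insert_if)
    moreover have "\<exists>C\<ge>0. \<forall>e\<in>insert e' E. \<forall>x. norm (s x e) \<le> C * ?S' x"
    proof -
      \<comment> \<open>As \<open>e'\<close> is \<open>k\<close> times the residual, the triangle
        inequality applies. The factor \<open>max 1 C\<close> covers both kinds of \<open>e\<close>:
        those in \<open>E0\<close> occur in \<open>?S'\<close> itself, those in \<open>E\<close>
        satisfy the bound with \<open>C\<close>.\<close>
      define M where "M = norm k * (1 + (\<Sum>e\<in>?D. norm (s f e) * max 1 C))"
      have M0: "M \<ge> 0" unfolding M_def by (intro mult_nonneg_nonneg add_nonneg_nonneg sum_nonneg) auto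
      have "norm (s x e') \<le> M * ?S' x" for x
      proof -
        have "norm (s e x) \<le> max 1 C * ?S' x" if "e \<in> ?D" for e
        proof -
          have "norm (s e x) = norm (s x e)" using conjugate_sym[of e x] by simp
          also have "\<dots> \<le> max 1 C * ?S' x"
          proof (cases "e \<in> E")
            case True
            have "C * ?S' x \<le> max 1 C * ?S' x" by (intro mult_right_mono S0) auto
            with bound[OF True, of x] show ?thesis by linarith
          next
            case False
            have "1 * ?S' x \<le> max 1 C * ?S' x" by (intro mult_right_mono S0) auto
            with False S_ge[of e x] that show ?thesis by auto
          qed
          finally show ?thesis .
        qed
        then have "norm (\<Sum>e\<in>?D. s f e * s e x) \<le> (\<Sum>e\<in>?D. norm (s f e) * (max 1 C * ?S' x))"
          by (intro order_trans[OF norm_sum] sum_mono) (auto simp: norm_mult intro!: mult_left_mono)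
        moreover have "norm (s f x) \<le> ?S' x" 
          using S_ge[of f x] conjugate_sym[of f x] by simp
        ultimately have "norm (s r x) \<le> ?S' x + (\<Sum>e\<in>?D. norm (s f e) * (max 1 C * ?S' x))"
          unfolding sr using norm_triangle_ineq4[of "s f x" "\<Sum>e\<in>?D. s f e * s e x"] by linarith
        also have "\<dots> = (1 + (\<Sum>e\<in>?D. norm (s f e) * max 1 C)) * ?S' x"
          by (simp add: algebra_simps sum_distrib_left sum_distrib_right)
        finally have "norm k * norm (s r x) \<le> M * ?S' x"
          unfolding M_def mult.assoc by (rule mult_left_mono) simp
        moreover have "norm (s x e') = norm k * norm (s r x)"
          using conjugate_sym[of x e'] by (simp add: e'_def scale_left norm_mult)
        ultimately show ?thesis by simp
      qed
      moreover have max: "M * ?S' x \<le> max C M * ?S' x" "C * ?S' x \<le> max C M * ?S' x" for x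
        by (intro mult_right_mono S0; simp)+
      ultimately have "norm (s x g) \<le> max C M * ?S' x" if "g \<in> insert e' E" for x g
        using that bound[of g x] order_trans[OF _ max(1)] order_trans[OF _ max(2)] by blast
      then show ?thesis using M0 by (intro exI[of _ "max C M"]) auto
    qed
    ultimately show ?thesis
      using E(1) e'_notin on unfolding D'[symmetric]
      by (intro exI[of _ "insert e' E"] conjI) auto
  qed
qed

text \<open>The residual of \<open>g\<close> is orthogonal to \<open>E\<close>, hence to each
  \<open>f\<close> in \<open>F\<close> by its expansion; by totality it vanishes on
  \<open>B\<close>.\<close>

lemma parseval_total:
  assumes E: "orthonormal E" "\<And>f. f \<in> F \<Longrightarrow> parseval E f"
    and total: "\<And>x b. (\<And>f. f \<in> F \<Longrightarrow> s x f = 0) \<Longrightarrow> b \<in> B \<Longrightarrow> x b = 0"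
  shows "parseval E g"
  unfolding parseval_def
proof
  fix x
  define r where "r = (\<lambda>b. g b - (\<Sum>e\<in>E. s g e * e b))"
  have sr: "s r x = s g x - (\<Sum>e\<in>E. s g e * s e x)" for x
    unfolding r_def by (rule diff_sum_left) (rule orthonormal_finite[OF E(1)])
  have "s r f = 0" if "f \<in> F" for f
  proof -
    have "s f r = (\<Sum>e\<in>E. s f e * conjugate (s r e))"
      by (rule parsevalD[OF E(2)[OF that]])
    also have "\<dots> = 0"
      using sum_orthonormal[OF E(1)] by (intro sum.neutral) (auto simp: sr)
    finally show ?thesis using eq_zero_sym by blast
  qed
  then have "r b = 0" if "b \<in> B" for b
    using that by (rule total)
  then have "s r x = 0" by (rule null)
  then show "s g x = (\<Sum>e\<in>E. s g e * conjugate (s x e))"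
    using sr[of x] by (simp add: conjugate_sym[symmetric])
qed

text \<open>A trace computation: the coordinate projections of \<open>id = \<Sum> \<langle>_, e\<rangle> e\<close> are summed over \<open>B\<close>.\<close>

lemma card_orthonormal_basis:
  assumes E: "orthonormal E" and full: "\<And>g. parseval E g"
  shows "card E = card B"
proof -
  define \<delta> :: "'b \<Rightarrow> 'b \<Rightarrow> 'k" where "\<delta> b = (\<lambda>c. if c = b then 1 else 0)" for b
  have fin: "finite E" by (rule orthonormal_finite[OF E])
  have 1: "(\<Sum>e\<in>E. s (\<delta> b) e * e b) = 1" if b: "b \<in> B" for b
  proof -
    define r where "r = (\<lambda>c. \<delta> b c - (\<Sum>e\<in>E. s (\<delta> b) e * e c))"
    have "s r x = 0" for x
      unfolding r_def diff_sum_left[OF fin] using parsevalD[OF full, of "\<delta> b" x]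
      by (simp add: conjugate_sym[symmetric])
    from self_eq_zeroD[OF this b] show ?thesis by (simp add: r_def \<delta>_def)
  qed
  have 2: "(\<Sum>b\<in>B. e b * s (\<delta> b) e) = 1" if e: "e \<in> E" for e
  proof -
    have "s (\<lambda>c. e c - (\<Sum>b\<in>B. e b * \<delta> b c)) e = 0"
      using finite_index by (intro null) (simp add: \<delta>_def if_distrib cong: if_cong)
    then have "s e e = (\<Sum>b\<in>B. e b * s (\<delta> b) e)"
      by (simp add: diff_sum_left[OF finite_index])
    with E e show ?thesis by (simp add: orthonormal_def)
  qed
  have "(of_nat (card B) :: 'k) = (\<Sum>b\<in>B. \<Sum>e\<in>E. s (\<delta> b) e * e b)"
    using 1 by simp
  also have "\<dots> = (\<Sum>e\<in>E. \<Sum>b\<in>B. e b * s (\<delta> b) e)"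
    by (subst sum.swap) (simp add: mult.commute)
  also have "\<dots> = of_nat (card E)"
    using 2 by simp
  finally show ?thesis by simp
qed

end

section \<open>Parseval's identity and frame bounds\<close>

context fun_ip
begin

lemma norm_self_eq:
  assumes "parseval E x"
  shows "norm (s x x) = (\<Sum>e\<in>E. (norm (s x e))\<^sup>2)"
proof -
  have "s x x = of_real (\<Sum>e\<in>E. (norm (s x e))\<^sup>2)"
    by (subst parsevalD[OF assms]) (rule sum_mult_conjugate)
  then show ?thesis by (simp only: norm_of_real) (simp add: sum_nonneg)
qed

text \<open>The upper bound is Cauchy-Schwarz in an orthonormal basis; for the lower one the
  Gram-Schmidt estimate controls each coordinate by the products with the given vectors.\<close>

lemma frame_bounds:
  assumes V: "finite V"
    and total: "\<And>x b. (\<And>v. v \<in> V \<Longrightarrow> s x (\<phi> v) = 0) \<Longrightarrow> b \<in> B \<Longrightarrow> x b = 0"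
  shows "\<exists>a b :: real. 0 < a \<and> a \<le> b \<and> (\<forall>x. a * norm (s x x) \<le> (\<Sum>v\<in>V. (norm (s x (\<phi> v)))\<^sup>2) \<and>
    (\<Sum>v\<in>V. (norm (s x (\<phi> v)))\<^sup>2) \<le> b * norm (s x x))"
proof -
  obtain E C where E: "orthonormal E" "\<And>f. f \<in> \<phi> ` V \<Longrightarrow> parseval E f" "C \<ge> 0"
      "\<And>e x. e \<in> E \<Longrightarrow> norm (s x e) \<le> C * (\<Sum>f\<in>\<phi> ` V. norm (s x f))"
    using gram_schmidt[OF finite_imageI[OF V, of \<phi>] orthonormal_empty] unfolding Un_empty_left by blast
  have full: "parseval E g" for g
  proof (rule parseval_total[OF E(1,2)])
    fix x b assume *: "\<And>f. f \<in> \<phi> ` V \<Longrightarrow> s x f = 0" "b \<in> B"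
    show "x b = 0" by (rule total[of x b, OF *(1) *(2)]) (rule imageI)
  qed
  define S where "S x = (\<Sum>v\<in>V. (norm (s x (\<phi> v)))\<^sup>2)" for x
  define N where "N = real (card (\<phi> ` V))"
  \<comment> \<open>Each coordinate costs the square of \<open>C\<close> times \<open>N\<close>,
    where \<open>N\<close> comes from squaring a sum of \<open>N\<close> terms; the
    \<open>+ 1\<close> keeps \<open>K\<close> positive even if the product is 0.\<close>
  define K where "K = real (card E) * (C\<^sup>2 * N) + 1"
  have S0: "S x \<ge> 0" for x unfolding S_def by (intro sum_nonneg) simp
  have K0: "K > 0" using E(3) by (simp add: K_def N_def add_nonneg_pos)
  have lower: "norm (s x x) \<le> K * S x" for x
  proof -
    have "(norm (s x e))\<^sup>2 \<le> C\<^sup>2 * N * S x" if e: "e \<in> E" for e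
    proof -
      have "(norm (s x e))\<^sup>2 \<le> (C * (\<Sum>f\<in>\<phi> ` V. norm (s x f)))\<^sup>2"
        by (rule power_mono[OF E(4)[OF e]]) simp
      also have "\<dots> = C\<^sup>2 * (\<Sum>f\<in>\<phi> ` V. norm (s x f))\<^sup>2" by (rule power_mult_distrib)
      also have "\<dots> \<le> C\<^sup>2 * ((\<Sum>f\<in>\<phi> ` V. (norm (s x f))\<^sup>2) * N)"
        unfolding N_def by (intro mult_left_mono sum_squared_le_sum_of_squares) simp
      \<comment> \<open>The image merges repeated vectors, so its sum is at most the sum over
        \<open>V\<close>.\<close>
      also have "\<dots> \<le> C\<^sup>2 * (S x * N)"
        using sum_image_le[OF V, of "\<lambda>f. (norm (s x f))\<^sup>2" \<phi>]
        by (intro mult_left_mono mult_right_mono) (auto simp: S_def N_def o_def)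
      finally show ?thesis by (simp add: mult_ac)
    qed
    then have "norm (s x x) \<le> real (card E) * (C\<^sup>2 * N * S x)"
      unfolding norm_self_eq[OF full] by (rule sum_bounded_above)
    also have "\<dots> \<le> K * S x" using S0[of x] by (simp add: K_def algebra_simps)
    finally show ?thesis .
  qed
  have upper: "S x \<le> (\<Sum>v\<in>V. norm (s (\<phi> v) (\<phi> v))) * norm (s x x)" for x
  proof -
    have "(norm (s x (\<phi> v)))\<^sup>2 \<le> norm (s (\<phi> v) (\<phi> v)) * norm (s x x)" for v
    proof -
      have "norm (s x (\<phi> v)) \<le> (\<Sum>e\<in>E. norm (s x e) * norm (s (\<phi> v) e))"
        by (subst parsevalD[OF full], rule order_trans[OF norm_sum]) (simp add: norm_mult)
      then have "(norm (s x (\<phi> v)))\<^sup>2 \<le> (\<Sum>e\<in>E. norm (s x e) * norm (s (\<phi> v) e))\<^sup>2"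
        by (rule power_mono) simp
      also have "\<dots> \<le> norm (s x x) * norm (s (\<phi> v) (\<phi> v))"
        unfolding norm_self_eq[OF full] by (rule Cauchy_Schwarz_ineq_sum)
      finally show ?thesis by (simp add: mult.commute)
    qed
    then show ?thesis unfolding S_def sum_distrib_right by (rule sum_mono)
  qed
  \<comment> \<open>The summand \<open>1 / K\<close> makes the upper constant at least the lower
    constant \<open>1 / K\<close>.\<close>
  define b where "b = (\<Sum>v\<in>V. norm (s (\<phi> v) (\<phi> v))) + 1 / K"
  have "1 / K * norm (s x x) \<le> S x" for x
    using lower[of x] K0 by (simp add: field_simps)
  moreover have "S x \<le> b * norm (s x x)" for x
  proof -
    have "0 \<le> 1 / K * norm (s x x)" using K0 by simp
    with upper[of x] show ?thesis unfolding b_def distrib_right by linarith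
  qed
  moreover have "0 < 1 / K" using K0 by simp
  moreover have "1 / K \<le> b" by (simp add: b_def sum_nonneg)
  ultimately show ?thesis unfolding S_def by blast
qed

end

subsection \<open>Frames and Gram matrices\<close>

definition std_ip :: "'b set \<Rightarrow> ('b \<Rightarrow> 'k::rc_field) \<Rightarrow> ('b \<Rightarrow> 'k) \<Rightarrow> 'k" where
  "std_ip B f g = (\<Sum>b\<in>B. f b * conjugate (g b))"

lemma fun_ip_std_ip:
  assumes "finite B"
  shows "fun_ip B (std_ip B :: ('b \<Rightarrow> 'k::rc_field) \<Rightarrow> _)"
proof
  show "finite B" by fact
next
  fix f g h :: "'b \<Rightarrow> 'k"
  show "std_ip B (\<lambda>b. f b + g b) h = std_ip B f h + std_ip B g h"
    by (simp add: std_ip_def distrib_right sum.distrib)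
next
  fix f h :: "'b \<Rightarrow> 'k" and c
  show "std_ip B (\<lambda>b. c * f b) h = c * std_ip B f h"
    by (simp add: std_ip_def sum_distrib_left mult.assoc)
next
  fix f g :: "'b \<Rightarrow> 'k"
  show "std_ip B g f = conjugate (std_ip B f g)"
    unfolding std_ip_def sum_conjugate[OF assms] by (simp add: conjugate_dist_mul mult.commute)
next
  fix f :: "'b \<Rightarrow> 'k" and b
  assume "b \<in> B" "f b \<noteq> 0"
  then have "0 < (\<Sum>b\<in>B. (norm (f b))\<^sup>2)"
    using assms by (intro sum_pos2[of B b]) auto
  then show "\<exists>r>0. std_ip B f f = of_real r"
    unfolding std_ip_def sum_mult_conjugate by blast
next
  fix f g :: "'b \<Rightarrow> 'k"
  assume "\<And>b. b \<in> B \<Longrightarrow> f b = 0"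
  then show "std_ip B f g = 0" by (simp add: std_ip_def)
qed

text \<open>The vectors \<open>c u\<close> are given by their coordinates in an orthonormal basis indexed by \<open>B\<close>; the
  last conjunct says that they span.\<close>

definition gram_rep :: "'v pair_pre_digraph \<Rightarrow> 'b set \<Rightarrow> ('v \<Rightarrow> 'b \<Rightarrow> 'k::rc_field) \<Rightarrow> bool" where
  "gram_rep G B c \<longleftrightarrow>
    (\<forall>u\<in>pverts G. \<forall>v\<in>pverts G. u \<noteq> v \<longrightarrow> ((u, v) \<in> parcs G \<longleftrightarrow> std_ip B (c u) (c v) \<noteq> 0)) \<and>
    (\<forall>y. (\<forall>u\<in>pverts G. std_ip B y (c u) = 0) \<longrightarrow> (\<forall>b\<in>B. y b = 0))"

lemma gram_rep_adj:
  "gram_rep G B c \<Longrightarrow> u \<in> pverts G \<Longrightarrow> v \<in> pverts G \<Longrightarrow> u \<noteq> v \<Longrightarrow>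
    (u, v) \<in> parcs G \<longleftrightarrow> std_ip B (c u) (c v) \<noteq> 0"
  by (simp add: gram_rep_def)

lemma gram_rep_total:
  "gram_rep G B c \<Longrightarrow> (\<And>u. u \<in> pverts G \<Longrightarrow> std_ip B y (c u) = 0) \<Longrightarrow> b \<in> B \<Longrightarrow> y b = 0"
  unfolding gram_rep_def by blast

lemma std_ip_reindex:
  "bij_betw f A B \<Longrightarrow> std_ip A (\<lambda>a. x (f a)) (\<lambda>a. y (f a)) = std_ip B x y"
  unfolding std_ip_def by (rule sum.reindex_bij_betw)

text \<open>Lets orthonormal sets and sum types be replaced by \<open>{..<d}\<close> as index sets;
  totality is transferred by carrying a test function along the inverse bijection.\<close>

lemma gram_rep_reindex:
  assumes f: "bij_betw f A B" and c: "gram_rep G B c"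
  shows "gram_rep G A (\<lambda>u a. c u (f a))"
  unfolding gram_rep_def
proof (intro conjI allI impI ballI)
  fix u v assume "u \<in> pverts G" "v \<in> pverts G" "u \<noteq> v"
  then show "(u, v) \<in> parcs G \<longleftrightarrow> std_ip A (\<lambda>a. c u (f a)) (\<lambda>a. c v (f a)) \<noteq> 0"
    using gram_rep_adj[OF c] by (simp add: std_ip_reindex[OF f])
next
  fix y a assume y: "\<forall>u\<in>pverts G. std_ip A y (\<lambda>a. c u (f a)) = 0" and a: "a \<in> A"
  define y' where "y' b = y (inv_into A f b)" for b
  have y': "y' (f a) = y a" if "a \<in> A" for a
    using that f by (simp add: y'_def bij_betw_def)
  have "std_ip B y' (c u) = std_ip A y (\<lambda>a. c u (f a))" for u
  proof -
    have "std_ip B y' (c u) = std_ip A (\<lambda>a. y' (f a)) (\<lambda>a. c u (f a))"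
      by (rule std_ip_reindex[OF f, symmetric])
    also have "\<dots> = std_ip A y (\<lambda>a. c u (f a))"
      unfolding std_ip_def by (rule sum.cong) (simp_all add: y')
    finally show ?thesis .
  qed
  then have "y' (f a) = 0"
    using y a f by (intro gram_rep_total[OF c, of y' "f a"]) (auto simp: bij_betw_def)
  with y' a show "y a = 0" by simp
qed

text \<open>The coordinates against \<open>E\<close> are those of the projections onto the
  orthogonal complement of \<open>E0\<close>, and the product of two projections is
  \<open>s (\<phi> u) (\<phi> v)\<close> minus its \<open>E0\<close> part; hence the form of the
  adjacency hypothesis. With \<open>E0 = {}\<close> they are the coordinates of the vectors
  themselves.\<close>

lemma (in fun_ip) gram_rep_orthonormal:
  assumes V: "finite (pverts G)" and E0: "orthonormal E0"
    and adj: "\<And>u v. u \<in> pverts G \<Longrightarrow> v \<in> pverts G \<Longrightarrow> u \<noteq> v \<Longrightarrow>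
      (u, v) \<in> parcs G \<longleftrightarrow> s (\<phi> u) (\<phi> v) \<noteq> (\<Sum>e\<in>E0. s (\<phi> u) e * conjugate (s (\<phi> v) e))"
  shows "\<exists>E. E0 \<inter> E = {} \<and> orthonormal (E0 \<union> E) \<and> card E \<le> card (pverts G) \<and>
    (\<forall>u\<in>pverts G. parseval (E0 \<union> E) (\<phi> u)) \<and> gram_rep G E (\<lambda>u. s (\<phi> u)) \<and>
    (\<forall>x. (\<forall>f\<in>E0 \<union> \<phi> ` pverts G. s x f = 0) \<longrightarrow> (\<forall>e\<in>E. s x e = 0))"
proof -
  let ?V = "pverts G"
  obtain E C where E: "E0 \<inter> E = {}" "orthonormal (E0 \<union> E)" "card E \<le> card (\<phi> ` ?V)"
      "\<And>f. f \<in> \<phi> ` ?V \<Longrightarrow> parseval (E0 \<union> E) f"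
      "\<And>e x. e \<in> E \<Longrightarrow> norm (s x e) \<le> C * (\<Sum>f\<in>E0 \<union> \<phi> ` ?V. norm (s x f))"
    using gram_schmidt[OF finite_imageI[OF V, of \<phi>] E0] by blast
  have fin: "finite E0" "finite E" using orthonormal_finite[OF E(2)] by auto
  have ann: "s x e = 0" if "\<forall>f\<in>E0 \<union> \<phi> ` ?V. s x f = 0" "e \<in> E" for x e
  proof -
    have "(\<Sum>f\<in>E0 \<union> \<phi> ` ?V. norm (s x f)) = 0" using that(1) by (intro sum.neutral) simp
    with E(5)[OF that(2), of x] show ?thesis by simp
  qed
  have "gram_rep G E (\<lambda>u. s (\<phi> u))"
    unfolding gram_rep_def
  proof (intro conjI ballI impI allI)
    fix u v assume uv: "u \<in> ?V" "v \<in> ?V" "u \<noteq> v"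
    have "s (\<phi> u) (\<phi> v) = (\<Sum>e\<in>E0 \<union> E. s (\<phi> u) e * conjugate (s (\<phi> v) e))"
      by (rule parsevalD[OF E(4)]) (use uv in simp)
    also have "\<dots> = (\<Sum>e\<in>E0. s (\<phi> u) e * conjugate (s (\<phi> v) e)) + std_ip E (s (\<phi> u)) (s (\<phi> v))"
      unfolding std_ip_def by (rule sum.union_disjoint) (use fin E(1) in auto)
    finally show "(u, v) \<in> parcs G \<longleftrightarrow> std_ip E (s (\<phi> u)) (s (\<phi> v)) \<noteq> 0"
      using adj[OF uv] by simp
  next
    fix y e assume y: "\<forall>u\<in>?V. std_ip E y (s (\<phi> u)) = 0" and e: "e \<in> E"
    \<comment> \<open>The coefficients \<open>y\<close> are realised by a vector in the span of
      \<open>E\<close>. It is orthogonal to \<open>E0\<close> and to all \<open>\<phi> u\<close>,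
      hence to \<open>E\<close>, and its product with \<open>e\<close> is
      \<open>y e\<close>.\<close>
    define Y where "Y = (\<lambda>b. \<Sum>e\<in>E. y e * e b)"
    have sY: "s Y g = (\<Sum>e\<in>E. y e * s e g)" for g
      unfolding Y_def by (rule sum_left) (rule fin)
    have "s Y g = 0" if g: "g \<in> E0 \<union> \<phi> ` ?V" for g
    proof (cases "g \<in> E0")
      case True
      have "s e g = 0" if "e \<in> E" for e
        using that True E(1,2) by (auto simp: orthonormal_def)
      then show ?thesis by (simp add: sY)
    next
      case False
      with g obtain u where u: "u \<in> ?V" "g = \<phi> u" by auto
      have "s Y g = std_ip E y (s (\<phi> u))"
        unfolding sY std_ip_def u(2) by (intro sum.cong arg_cong2[of _ _ _ _ "(*)"] refl conjugate_sym)
      with y u show ?thesis by simp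
    qed
    then have "s Y e = 0" using e by (intro ann) auto
    moreover have "s Y e = y e"
      unfolding sY by (rule sum_orthonormal) (use E(2) e in \<open>auto simp: orthonormal_def\<close>)
    ultimately show "y e = 0" by simp
  qed
  moreover have "card E \<le> card ?V" using E(3) card_image_le[OF V, of \<phi>] by linarith
  moreover have "\<forall>u\<in>?V. parseval (E0 \<union> E) (\<phi> u)" using E(4) by blast
  moreover have "\<forall>x. (\<forall>f\<in>E0 \<union> \<phi> ` ?V. s x f = 0) \<longrightarrow> (\<forall>e\<in>E. s x e = 0)"
    by (intro allI impI ballI) (rule ann)
  ultimately show ?thesis using E(1,2) by (intro exI[of _ E] conjI)
qed

section \<open>Frame graphs and Gram representations\<close>

text \<open>Arcs are pairs of vertices and both graphs have the projections as tail and head, so the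
  vertex map of an isomorphism forces its arc map.\<close>

lemma digraph_iso_with_proj_iff:
  assumes "pair_wf_digraph P" "pair_wf_digraph Q"
  shows "digraph_iso (with_proj P) (with_proj Q) \<longleftrightarrow>
    (\<exists>f. bij_betw f (pverts P) (pverts Q) \<and>
      (\<forall>u\<in>pverts P. \<forall>v\<in>pverts P. (u, v) \<in> parcs P \<longleftrightarrow> (f u, f v) \<in> parcs Q))"
    (is "?L \<longleftrightarrow> ?R")
proof
  interpret P: pair_wf_digraph P by fact
  assume ?L
  then obtain h where h: "pre_digraph.digraph_isomorphism (with_proj P) h"
    and Q: "with_proj Q = app_iso h (with_proj P)"
    unfolding digraph_iso_def by blast
  let ?f = "iso_verts h"
  have inj: "inj_on ?f (pverts P)"
    and ends: "\<And>a. a \<in> parcs P \<Longrightarrow> ?f (fst a) = iso_tail h (iso_arcs h a) \<and>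
      ?f (snd a) = iso_head h (iso_arcs h a)"
    using h by (auto simp: pre_digraph.digraph_isomorphism_def)
  have Q': "pverts Q = ?f ` pverts P" "parcs Q = iso_arcs h ` parcs P" "iso_tail h = fst" "iso_head h = snd"
    using arg_cong[OF Q, of verts] arg_cong[OF Q, of arcs] arg_cong[OF Q, of tail] arg_cong[OF Q, of head]
    by (simp_all)
  have arc: "iso_arcs h a = (?f (fst a), ?f (snd a))" if "a \<in> parcs P" for a
    using ends[OF that] Q'(3,4) by (simp add: prod_eq_iff)
  have "(u, v) \<in> parcs P \<longleftrightarrow> (?f u, ?f v) \<in> parcs Q" if uv: "u \<in> pverts P" "v \<in> pverts P" for u v
  proof
    assume "(u, v) \<in> parcs P"
    then show "(?f u, ?f v) \<in> parcs Q" using arc[of "(u, v)"] unfolding Q' by force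
  next
    assume "(?f u, ?f v) \<in> parcs Q"
    then obtain a where a: "a \<in> parcs P" "?f u = ?f (fst a)" "?f v = ?f (snd a)"
      unfolding Q' by (auto simp: arc)
    then have "u = fst a" "v = snd a"
      using uv P.arc_fst_in_verts[OF a(1)] P.arc_snd_in_verts[OF a(1)] inj by (auto dest: inj_onD)
    with a show "(u, v) \<in> parcs P" by simp
  qed
  then show ?R using inj Q'(1) by (intro exI[of _ ?f]) (auto simp: bij_betw_def)
next
  interpret P: pair_wf_digraph P by fact
  interpret Q: pair_wf_digraph Q by fact
  assume ?R
  then obtain f where f: "bij_betw f (pverts P) (pverts Q)"
    and adj: "\<And>u v. u \<in> pverts P \<Longrightarrow> v \<in> pverts P \<Longrightarrow> (u, v) \<in> parcs P \<longleftrightarrow> (f u, f v) \<in> parcs Q"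
    by blast
  define h where "h = \<lparr>iso_verts = f, iso_arcs = map_prod f f, iso_head = snd, iso_tail = fst\<rparr>"
  have inj: "inj_on f (pverts P)" and im: "f ` pverts P = pverts Q"
    using f by (auto simp: bij_betw_def)
  have "inj_on (map_prod f f) (parcs P)"
  proof (rule inj_onI)
    fix a b assume "a \<in> parcs P" "b \<in> parcs P" "map_prod f f a = map_prod f f b"
    then show "a = b"
      using inj_onD[OF inj, of "fst a" "fst b"] inj_onD[OF inj, of "snd a" "snd b"]
      by (simp add: prod_eq_iff P.arc_fst_in_verts P.arc_snd_in_verts)
  qed
  then have "P.digraph_isomorphism h"
    using inj by (simp add: P.digraph_isomorphism_def h_def P.wf_digraph_axioms)
  moreover have "parcs Q = map_prod f f ` parcs P"
  proof (intro equalityI subsetI)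
    fix a assume a: "a \<in> parcs Q"
    then obtain u v where uv: "u \<in> pverts P" "v \<in> pverts P" "fst a = f u" "snd a = f v"
      using Q.arc_fst_in_verts[OF a] Q.arc_snd_in_verts[OF a] unfolding im[symmetric] by blast
    then have a': "a = (f u, f v)" by (simp add: prod_eq_iff)
    then have "(u, v) \<in> parcs P" using a adj[OF uv(1,2)] by simp
    then show "a \<in> map_prod f f ` parcs P" unfolding a' by (intro image_eqI[of _ _ "(u, v)"]) simp_all
  next
    fix a assume "a \<in> map_prod f f ` parcs P"
    then obtain u v where uv: "(u, v) \<in> parcs P" "a = (f u, f v)" by auto
    then show "a \<in> parcs Q" using adj[OF P.in_arcsD1 P.in_arcsD2, OF uv(1) uv(1)] by simp
  qed
  then have "with_proj Q = app_iso h (with_proj P)"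
    using im by (simp add: with_proj_def app_iso_def h_def)
  ultimately show ?L unfolding digraph_iso_def by blast
qed

lemma pair_wf_digraph_frame_graph: "pair_wf_digraph (frame_graph ip fs)"
  by unfold_locales (auto simp: frame_graph_def)

text \<open>Coordinates against an orthonormal set obtained from the frame turn the arbitrary inner
  product into the standard one. The lower frame bound makes this set a basis, so it has
  \<open>d\<close> elements; at most one arises from each vertex, which gives the second
  claim.\<close>

lemma gram_rep_if_is_frame_graph:
  fixes G :: "'v pair_pre_digraph"
  assumes "pair_fin_digraph G" and "is_frame_graph_in_dim TYPE('k::rc_field) d G"
  shows "\<exists>c :: 'v \<Rightarrow> nat \<Rightarrow> 'k. gram_rep G {..<d} c" and "d \<le> card (pverts G)"
proof -
  interpret G: pair_fin_digraph G by fact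
  obtain ip :: "'k vec \<Rightarrow> 'k vec \<Rightarrow> 'k" and fs where ip: "inner_product_space d ip"
    and frame: "finite_frame d ip fs"
    and iso: "digraph_iso (with_proj (frame_graph ip fs)) (with_proj G)"
    using assms(2) unfolding is_frame_graph_in_dim_def by blast
  interpret inner_product_space d ip by (rule ip)
  obtain f where f: "bij_betw f {..<length fs} (pverts G)"
    and adj: "\<And>i j. i < length fs \<Longrightarrow> j < length fs \<Longrightarrow>
      (i \<noteq> j \<and> ip (fs ! i) (fs ! j) \<noteq> 0) \<longleftrightarrow> (f i, f j) \<in> parcs G"
    using iso digraph_iso_with_proj_iff[OF pair_wf_digraph_frame_graph G.pair_wf_digraph_axioms, of ip fs]
    by (auto simp: frame_graph_def)
  have inj: "inj_on f {..<length fs}" and im: "f ` {..<length fs} = pverts G"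
    using f by (auto simp: bij_betw_def)
  define g where "g = inv_into {..<length fs} f"
  have gf: "g (f i) = i" if "i < length fs" for i
    using inj that by (simp add: g_def)
  have g: "g v < length fs" "f (g v) = v" if "v \<in> pverts G" for v
    using that gf unfolding im[symmetric] by auto
  define \<phi> where "\<phi> v = vec_index (fs ! g v)" for v
  define s where "s x y = ip (vec d x) (vec d y)" for x y
  have carrier: "fs ! i \<in> carrier_vec d" if "i < length fs" for i
    using frame that nth_mem[OF that] unfolding finite_frame_def by blast
  have vec_\<phi>: "vec d (\<phi> v) = fs ! g v" if "v \<in> pverts G" for v
    using carrier[OF g(1)[OF that]] by (intro eq_vecI) (auto simp: \<phi>_def)
  interpret s: fun_ip "{..<d}" s
  proof
    show "finite {..<d}" by simp
  next
    fix x y z :: "nat \<Rightarrow> 'k"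
    have "vec d (\<lambda>b. x b + y b) = vec d x + vec d y" by (intro eq_vecI) auto
    then show "s (\<lambda>b. x b + y b) z = s x z + s y z" by (simp add: s_def ip_add_left)
  next
    fix x z :: "nat \<Rightarrow> 'k" and c
    have "vec d (\<lambda>b. c * x b) = c \<cdot>\<^sub>v vec d x" by (intro eq_vecI) auto
    then show "s (\<lambda>b. c * x b) z = c * s x z" by (simp add: s_def ip_smult_left)
  next
    fix x y :: "nat \<Rightarrow> 'k"
    show "s y x = conjugate (s x y)" unfolding s_def by (rule ip_conjugate) auto
  next
    fix x :: "nat \<Rightarrow> 'k" and b assume b: "b \<in> {..<d}" "x b \<noteq> 0"
    have "vec d x \<noteq> 0\<^sub>v d"
    proof
      assume "vec d x = 0\<^sub>v d"
      then have "vec_index (vec d x) b = vec_index (0\<^sub>v d) b" by simp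
      with b show False by simp
    qed
    then show "\<exists>r>0. s x x = of_real r" unfolding s_def by (intro ip_pos) auto
  next
    fix x y :: "nat \<Rightarrow> 'k" assume x: "\<And>b. b \<in> {..<d} \<Longrightarrow> x b = 0"
    have "vec d x = 0 \<cdot>\<^sub>v vec d x" using x by (intro eq_vecI) auto
    then have "s x y = ip (0 \<cdot>\<^sub>v vec d x) (vec d y)" by (simp add: s_def)
    also have "\<dots> = 0 * ip (vec d x) (vec d y)" by (rule ip_smult_left) auto
    finally show "s x y = 0" by simp
  qed
  have "(u, v) \<in> parcs G \<longleftrightarrow> s (\<phi> u) (\<phi> v) \<noteq> (\<Sum>e\<in>{}. s (\<phi> u) e * conjugate (s (\<phi> v) e))"
    if uv: "u \<in> pverts G" "v \<in> pverts G" "u \<noteq> v" for u v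
  proof -
    have "g u \<noteq> g v" using g(2)[OF uv(1)] g(2)[OF uv(2)] uv(3) by auto
    then show ?thesis
      using adj[OF g(1) g(1), OF uv(1,2)] uv by (simp add: s_def vec_\<phi> g(2))
  qed
  from s.gram_rep_orthonormal[OF G.pair_finite_verts s.orthonormal_empty this]
  obtain E where E: "s.orthonormal E" "card E \<le> card (pverts G)"
      "\<And>u. u \<in> pverts G \<Longrightarrow> s.parseval E (\<phi> u)" "gram_rep G E (\<lambda>u. s (\<phi> u))"
    unfolding Un_empty_left by blast
  obtain A :: real where A: "0 < A" "\<And>x. x \<in> carrier_vec d \<Longrightarrow>
      A * norm (ip x x) \<le> (\<Sum>i<length fs. (norm (ip x (fs ! i)))\<^sup>2)"
    using frame unfolding finite_frame_def by blast
  have full: "s.parseval E x" for x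
  proof (rule s.parseval_total[OF E(1)])
    fix h assume "h \<in> \<phi> ` pverts G"
    then show "s.parseval E h" using E(3) by blast
  next
    fix x b assume x: "\<And>h. h \<in> \<phi> ` pverts G \<Longrightarrow> s x h = 0" and b: "b \<in> {..<d}"
    have "ip (vec d x) (fs ! i) = 0" if i: "i < length fs" for i
    proof -
      have "f i \<in> pverts G" using i im by blast
      with x[of "\<phi> (f i)"] show ?thesis by (simp add: s_def vec_\<phi> gf[OF i])
    qed
    \<comment> \<open>A vector orthogonal to all frame vectors has norm 0 by the lower frame
      bound.\<close>
    then have "A * norm (s x x) \<le> 0" using A(2)[of "vec d x"] by (simp add: s_def)
    then have "s x x = 0" using A(1) by (simp add: mult_le_0_iff)
    then show "x b = 0" using b by (rule s.self_eq_zeroD)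
  qed
  have card: "card E = d" using s.card_orthonormal_basis[OF E(1) full] by simp
  then show "d \<le> card (pverts G)" using E(2) by simp
  obtain h where "bij_betw h {..<d} E"
    using ex_bij_betw_nat_finite[OF s.orthonormal_finite[OF E(1)]] card by (auto simp: atLeast0LessThan)
  from gram_rep_reindex[OF this E(4)] show "\<exists>c :: 'v \<Rightarrow> nat \<Rightarrow> 'k. gram_rep G {..<d} c" by blast
qed

text \<open>Totality yields both frame bounds by \<open>frame_bounds\<close>; the isomorphism sends
  a position in a repetition-free list of the vertices to the vertex found there.\<close>

lemma is_frame_graph_if_gram_rep:
  fixes G :: "'v pair_pre_digraph" and c :: "'v \<Rightarrow> 'b \<Rightarrow> 'k::rc_field"
  assumes "pair_digraph G" and "finite B" and "gram_rep G B c"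
  shows "is_frame_graph_in_dim TYPE('k) (card B) G"
proof -
  interpret G: pair_digraph G by fact
  define d where "d = card B"
  obtain h where "bij_betw h {..<d} B"
    using ex_bij_betw_nat_finite[OF assms(2)] by (auto simp: d_def atLeast0LessThan)
  from gram_rep_reindex[OF this assms(3)]
  obtain c :: "'v \<Rightarrow> nat \<Rightarrow> 'k" where c: "gram_rep G {..<d} c" by blast
  interpret s: fun_ip "{..<d}" "std_ip {..<d} :: _ \<Rightarrow> _ \<Rightarrow> 'k" by (rule fun_ip_std_ip) simp
  define ip :: "'k vec \<Rightarrow> 'k vec \<Rightarrow> 'k" where "ip x y = std_ip {..<d} (vec_index x) (vec_index y)" for x y
  obtain vs where vs: "set vs = pverts G" "distinct vs"
    using finite_distinct_list[OF G.pair_finite_verts] by blast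
  define fs where "fs = map (\<lambda>v. vec d (c v)) vs"
  have ip_vec: "ip x (vec d y) = std_ip {..<d} (vec_index x) y"
    "ip (vec d z) x = std_ip {..<d} z (vec_index x)" for x y z
    by (simp_all add: ip_def std_ip_def)
  have fs: "length fs = length vs" "\<And>i. i < length vs \<Longrightarrow> fs ! i = vec d (c (vs ! i))"
    by (simp_all add: fs_def)
  have "inner_product_space d ip"
  proof
    fix x y z :: "'k vec" assume *: "x \<in> carrier_vec d" "y \<in> carrier_vec d" "z \<in> carrier_vec d"
    have "ip (x + y) z = std_ip {..<d} (\<lambda>b. vec_index x b + vec_index y b) (vec_index z)"
      unfolding ip_def std_ip_def using * by (intro sum.cong) auto
    then show "ip (x + y) z = ip x z + ip y z" by (simp add: s.add_left ip_def)
  next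
    fix x y :: "'k vec" and c assume *: "x \<in> carrier_vec d" "y \<in> carrier_vec d"
    have "ip (c \<cdot>\<^sub>v x) y = std_ip {..<d} (\<lambda>b. c * vec_index x b) (vec_index y)"
      unfolding ip_def std_ip_def using * by (intro sum.cong) auto
    then show "ip (c \<cdot>\<^sub>v x) y = c * ip x y" by (simp add: s.scale_left ip_def)
  next
    fix x y :: "'k vec"
    show "ip y x = conjugate (ip x y)" unfolding ip_def by (rule s.conjugate_sym)
  next
    fix x :: "'k vec" assume x: "x \<in> carrier_vec d" "x \<noteq> 0\<^sub>v d"
    obtain b where "b < d" "vec_index x b \<noteq> 0"
    proof (rule ccontr)
      assume "\<not> thesis"
      then have "x = 0\<^sub>v d" using that x(1) by (intro eq_vecI) auto
      with x(2) show False ..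
    qed
    then show "\<exists>r>0. ip x x = of_real r" unfolding ip_def by (intro s.pos[of b]) auto
  qed
  moreover have "finite_frame d ip fs"
  proof -
    have total: "x b = 0"
      if x: "\<And>i. i \<in> {..<length vs} \<Longrightarrow> std_ip {..<d} x (c (vs ! i)) = 0" and b: "b \<in> {..<d}" for x b
    proof (rule gram_rep_total[OF c _ b])
      fix v assume "v \<in> pverts G"
      then obtain i where "i < length vs" "v = vs ! i"
        unfolding vs(1)[symmetric] in_set_conv_nth by blast
      with x[of i] show "std_ip {..<d} x (c v) = 0" by simp
    qed
    define S where "S x = (\<Sum>i<length vs. (norm (std_ip {..<d} x (c (vs ! i))))\<^sup>2)" for x
    have "\<exists>a b :: real. 0 < a \<and> a \<le> b \<and>
        (\<forall>x. a * norm (std_ip {..<d} x x) \<le> S x \<and> S x \<le> b * norm (std_ip {..<d} x x))"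
      unfolding S_def
    proof (rule s.frame_bounds)
      fix x b assume "\<And>i. i \<in> {..<length vs} \<Longrightarrow> std_ip {..<d} x (c (vs ! i)) = 0" "b \<in> {..<d}"
      then show "x b = 0" by (rule total[of x b])
    qed simp
    then obtain a b :: real where "0 < a" "a \<le> b"
      and ab: "\<And>x. a * norm (std_ip {..<d} x x) \<le> S x \<and> S x \<le> b * norm (std_ip {..<d} x x)"
      by blast
    have S: "(\<Sum>i<length fs. (norm (ip x (fs ! i)))\<^sup>2) = S (vec_index x)" for x
      unfolding S_def fs(1) by (intro sum.cong) (simp_all add: fs(2) ip_vec)
    have "set fs \<subseteq> carrier_vec d" by (auto simp: fs_def)
    then show ?thesis
      unfolding finite_frame_def S
      unfolding ip_def using \<open>0 < a\<close> \<open>a \<le> b\<close> ab by blast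
  qed
  moreover have "digraph_iso (with_proj (frame_graph ip fs)) (with_proj G)"
    unfolding digraph_iso_with_proj_iff[OF pair_wf_digraph_frame_graph G.pair_wf_digraph]
  proof (intro exI[of _ "(!) vs"] conjI ballI)
    show "bij_betw ((!) vs) (pverts (frame_graph ip fs)) (pverts G)"
      using bij_betw_nth[OF vs(2) refl refl] by (simp add: frame_graph_def fs vs(1))
  next
    fix i j assume ij: "i \<in> pverts (frame_graph ip fs)" "j \<in> pverts (frame_graph ip fs)"
    then have ij': "i < length vs" "j < length vs" by (simp_all add: frame_graph_def fs)
    have ip_fs: "ip (fs ! i) (fs ! j) = std_ip {..<d} (c (vs ! i)) (c (vs ! j))"
      using ij' by (simp add: fs ip_def std_ip_def)
    show "(i, j) \<in> parcs (frame_graph ip fs) \<longleftrightarrow> (vs ! i, vs ! j) \<in> parcs G"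
    proof (cases "i = j")
      case True
      then show ?thesis using G.no_loops'[of "vs ! j" "vs ! j"] by (auto simp: frame_graph_def)
    next
      case False
      then have "vs ! i \<noteq> vs ! j" using ij' vs(2) by (simp add: nth_eq_iff_index_eq)
      moreover have "vs ! i \<in> pverts G" "vs ! j \<in> pverts G"
        using ij' by (simp_all only: nth_mem flip: vs(1))
      ultimately have "(vs ! i, vs ! j) \<in> parcs G \<longleftrightarrow> ip (fs ! i) (fs ! j) \<noteq> 0"
        unfolding ip_fs using gram_rep_adj[OF c, of "vs ! i" "vs ! j"] by blast
      then show ?thesis using False ij' by (simp add: frame_graph_def fs(1))
    qed
  qed
  ultimately have "is_frame_graph_in_dim TYPE('k) d G"
    unfolding is_frame_graph_in_dim_def by (intro exI[of _ ip] exI[of _ fs] conjI)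
  then show ?thesis by (simp only: d_def)
qed

section \<open>Nonzero dimensions and vectors in general position\<close>

text \<open>Ensures dimension at least 1, the range in which the dimension hypotheses say
  anything.\<close>

lemma gram_rep_arc_nonempty:
  assumes "pair_digraph G" "gram_rep G B c" "parcs G \<noteq> {}"
  shows "B \<noteq> {}"
proof
  interpret G: pair_digraph G by fact
  assume B: "B = {}"
  obtain u v where uv: "(u, v) \<in> parcs G" using assms(3) by auto
  then have "std_ip B (c u) (c v) \<noteq> 0"
    using gram_rep_adj[OF assms(2), of u v] G.in_arcsD1 G.in_arcsD2 G.no_loops' by blast
  then show False by (simp add: B std_ip_def)
qed

text \<open>The vectors orthogonal to a nonzero \<open>x\<close> form a proper subspace, and over an
  infinite field finitely many proper subspaces do not cover the space.\<close>

lemma (in fun_ip) exists_not_orthogonal: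
  assumes "finite X" and "\<And>x. x \<in> X \<Longrightarrow> s x x \<noteq> 0"
  shows "\<exists>w. \<forall>x\<in>X. s w x \<noteq> 0"
  using assms
proof (induction X rule: finite_induct)
  case (insert x X)
  then obtain w where w: "\<And>y. y \<in> X \<Longrightarrow> s w y \<noteq> 0" by blast
  show ?case
  proof (cases "s w x = 0")
    case True
    have "infinite (UNIV :: 'k set)" by (rule infinite_UNIV_char_0)
    \<comment> \<open>Each \<open>y\<close> in \<open>X\<close> excludes at most one
      \<open>t\<close>, and \<open>x\<close> itself excludes 0. If \<open>s x y = 0\<close>, the
      quotient is 0 by convention and nothing new is excluded.\<close>
    then obtain t where t: "t \<notin> insert 0 ((\<lambda>y. - s w y / s x y) ` X)"
      using insert.hyps(1) by (meson ex_new_if_finite finite_imageI finite_insert)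
    have "s (\<lambda>b. w b + t * x b) y = s w y + t * s x y" for y
      by (simp only: add_left scale_left)
    moreover have "s w y + t * s x y \<noteq> 0" if "y \<in> insert x X" for y
    proof (cases "y = x")
      case True
      with \<open>s w x = 0\<close> t insert.prems show ?thesis by simp
    next
      case False
      with that have y: "y \<in> X" by simp
      show ?thesis
      proof
        assume "s w y + t * s x y = 0"
        then have *: "t * s x y = - s w y" by (simp add: eq_neg_iff_add_eq_0 add.commute)
        with w[OF y] have "s x y \<noteq> 0" by auto
        with * have "t = - s w y / s x y" by (simp add: field_simps)
        with t y show False by blast
      qed
    qed
    ultimately show ?thesis by (intro exI[of _ "\<lambda>b. w b + t * x b"]) simp
  next
    case False
    with w show ?thesis by (intro exI[of _ w]) blast
  qed
qed simp

text \<open>The vectors are the rows of the unsigned incidence matrix of vertices and arcs. Their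
  Gram matrix is twice the signless Laplacian: two adjacent vertices share the two arcs of their
  edge, other pairs share none. This makes the intervals in the dimension hypotheses
  nonempty.\<close>

lemma exists_frame_dim:
  fixes G :: "'v pair_pre_digraph"
  assumes "pair_graph G" "parcs G \<noteq> {}"
  shows "\<exists>d\<ge>1. is_frame_graph_in_dim TYPE('k::rc_field) d G"
proof -
  interpret G: pair_graph G by fact
  define \<phi> :: "'v \<Rightarrow> 'v \<times> 'v \<Rightarrow> 'k" where "\<phi> u = (\<lambda>(p, q). if u = p \<or> u = q then 1 else 0)" for u
  interpret s: fun_ip "parcs G" "std_ip (parcs G) :: _ \<Rightarrow> _ \<Rightarrow> 'k"
    by (rule fun_ip_std_ip) (rule G.pair_finite_arcs)
  have sym: "(u, v) \<in> parcs G \<Longrightarrow> (v, u) \<in> parcs G" for u v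
    using G.pair_sym_arcs by (simp add: symmetric_def sym_def)
  have "(u, v) \<in> parcs G \<longleftrightarrow> std_ip (parcs G) (\<phi> u) (\<phi> v) \<noteq>
      (\<Sum>e\<in>{}. std_ip (parcs G) (\<phi> u) e * conjugate (std_ip (parcs G) (\<phi> v) e))"
    if uv: "u \<in> pverts G" "v \<in> pverts G" "u \<noteq> v" for u v
  proof -
    have "std_ip (parcs G) (\<phi> u) (\<phi> v) = (\<Sum>a\<in>parcs G. if a \<in> {(u, v), (v, u)} then 1 else 0)"
      unfolding std_ip_def \<phi>_def by (intro sum.cong) (use \<open>u \<noteq> v\<close> in \<open>auto split: if_splits\<close>)
    also have "\<dots> = (\<Sum>a\<in>parcs G \<inter> {(u, v), (v, u)}. 1)"
      by (rule sum.inter_restrict[symmetric]) (rule G.pair_finite_arcs)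
    finally have "std_ip (parcs G) (\<phi> u) (\<phi> v) \<noteq> 0 \<longleftrightarrow> parcs G \<inter> {(u, v), (v, u)} \<noteq> {}"
      using G.pair_finite_arcs by simp
    also have "\<dots> \<longleftrightarrow> (u, v) \<in> parcs G" using sym by blast
    finally show ?thesis by simp
  qed
  from s.gram_rep_orthonormal[OF G.pair_finite_verts s.orthonormal_empty this]
  obtain E and c :: "'v \<Rightarrow> ('v \<times> 'v \<Rightarrow> 'k) \<Rightarrow> 'k" where E: "s.orthonormal E" "gram_rep G E c"
    unfolding Un_empty_left by blast
  have fin: "finite E" by (rule s.orthonormal_finite[OF E(1)])
  have "E \<noteq> {}" by (rule gram_rep_arc_nonempty[OF G.pair_digraph E(2) assms(2)])
  then have "card E \<ge> 1" using fin by (simp add: Suc_le_eq card_gt_0_iff)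
  with is_frame_graph_if_gram_rep[OF G.pair_digraph fin E(2)] show ?thesis by blast
qed

subsection \<open>The corona product\<close>

lemma connected_has_neighbour:
  assumes "pair_graph G" "Digraph_Component.connected (with_proj G)" "card (pverts G) \<ge> 2" "u \<in> pverts G"
  shows "\<exists>v. (u, v) \<in> parcs G"
proof -
  interpret G: pair_graph G by fact
  obtain v where v: "v \<in> pverts G" "v \<noteq> u"
  proof (rule ccontr)
    assume "\<not> thesis"
    then have "pverts G \<subseteq> {u}" using that by blast
    then have "card (pverts G) \<le> card {u}" by (rule card_mono[rotated]) simp
    with assms(3) show False by simp
  qed
  have "reachable (with_proj (mk_symmetric (with_proj G))) u v"
    using assms(2,4) v(1) unfolding connected_def strongly_connected_def by simp
  then have "(u, v) \<in> rtrancl_on (pverts G) (parcs (mk_symmetric (with_proj G)))"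
    by (simp add: reachable_def)
  then obtain w where "(u, w) \<in> parcs (mk_symmetric (with_proj G))"
    using v(2) by (cases rule: converse_rtrancl_on_cases) auto
  \<comment> \<open>Connectedness refers to the symmetrised graph, so the first step of the walk may
    be a reversed arc; symmetry of \<open>G\<close> repairs this.\<close>
  then have "(u, w) \<in> parcs G \<or> (w, u) \<in> parcs G" by (auto simp: parcs_mk_symmetric)
  moreover have "sym (parcs G)" using G.pair_sym_arcs by (simp add: symmetric_def)
  ultimately show ?thesis by (blast dest: symD)
qed

section \<open>The corona graph and frames built in a direct sum\<close>

lemma pverts_corona: "pverts (corona G H) = Inl ` pverts G \<union> Inr ` (pverts G \<times> pverts H)"
  by (simp add: corona_def)

lemma parcs_corona_iff:
  "(Inl u, Inl v) \<in> parcs (corona G H) \<longleftrightarrow> (u, v) \<in> parcs G"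
  "(Inl u, Inr (v, y)) \<in> parcs (corona G H) \<longleftrightarrow> u = v \<and> u \<in> pverts G \<and> y \<in> pverts H"
  "(Inr (u, x), Inl v) \<in> parcs (corona G H) \<longleftrightarrow> u = v \<and> u \<in> pverts G \<and> x \<in> pverts H"
  "(Inr (u, x), Inr (v, y)) \<in> parcs (corona G H) \<longleftrightarrow> u = v \<and> u \<in> pverts G \<and> (x, y) \<in> parcs H"
  by (auto simp: corona_def)

lemma pair_digraph_corona:
  assumes "pair_digraph G" "pair_digraph H"
  shows "pair_digraph (corona G H)"
proof -
  interpret G: pair_digraph G by fact
  interpret H: pair_digraph H by fact
  have sub: "parcs (corona G H) \<subseteq> pverts (corona G H) \<times> pverts (corona G H)"
    by (auto simp: corona_def dest: G.in_arcsD1 G.in_arcsD2 H.in_arcsD1 H.in_arcsD2)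
  have fin: "finite (pverts (corona G H))"
    by (simp add: pverts_corona G.pair_finite_verts H.pair_finite_verts)
  show ?thesis
  proof
    fix e assume e: "e \<in> parcs (corona G H)"
    show "fst e \<in> pverts (corona G H)" "snd e \<in> pverts (corona G H)" using e sub by auto
    show "fst e \<noteq> snd e" using e by (auto simp: corona_def dest: G.no_loops' H.no_loops')
  next
    show "finite (pverts (corona G H))" by (rule fin)
    show "finite (parcs (corona G H))" by (rule finite_subset[OF sub]) (simp add: fin)
  qed
qed

lemma card_pverts_corona:
  assumes "finite (pverts G)" "finite (pverts H)"
  shows "card (pverts (corona G H)) = card (pverts G) * card (pverts H) + card (pverts G)"
proof -
  have "card (pverts (corona G H)) =
      card (Inl ` pverts G :: ('a + 'a \<times> 'b) set) + card (Inr ` (pverts G \<times> pverts H) :: ('a + 'a \<times> 'b) set)"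
    unfolding pverts_corona by (rule card_Un_disjoint) (use assms in auto)
  then show ?thesis by (simp add: card_image card_cartesian_product)
qed

text \<open>The direct sum of \<open>K\<^sup>a\<close> and the spaces \<open>K\<^sup>b\<^sup>u\<close> (one for each vertex \<open>u\<close>), and its vectors with
  components \<open>p\<close> in \<open>K\<^sup>a\<close> and \<open>q\<close> in the summand of \<open>u\<close>.\<close>

definition direct_sum_index :: "nat \<Rightarrow> 'v set \<Rightarrow> ('v \<Rightarrow> nat) \<Rightarrow> (nat + 'v \<times> nat) set" where
  "direct_sum_index a V b = {..<a} <+> Sigma V (\<lambda>u. {..<b u})"

definition direct_sum_vec ::
  "(nat \<Rightarrow> 'k) \<Rightarrow> 'v \<Rightarrow> (nat \<Rightarrow> 'k) \<Rightarrow> nat + 'v \<times> nat \<Rightarrow> 'k::zero" where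
  "direct_sum_vec p u q = (\<lambda>i. case i of Inl j \<Rightarrow> p j | Inr (v, j) \<Rightarrow> if v = u then q j else 0)"

lemma std_ip_direct_sum:
  assumes "finite V" "u \<in> V"
  shows "std_ip (direct_sum_index a V b) y (direct_sum_vec p u q) =
    std_ip {..<a} (\<lambda>j. y (Inl j)) p + std_ip {..<b u} (\<lambda>j. y (Inr (u, j))) q"
proof -
  let ?f = "\<lambda>i. y i * conjugate (direct_sum_vec p u q i)"
  have "std_ip (direct_sum_index a V b) y (direct_sum_vec p u q) =
      (\<Sum>j<a. ?f (Inl j)) + (\<Sum>i\<in>Sigma V (\<lambda>u. {..<b u}). ?f (Inr i))"
    unfolding std_ip_def direct_sum_index_def
    by (subst sum.Plus) (simp_all add: assms o_def)
  also have "(\<Sum>j<a. ?f (Inl j)) = std_ip {..<a} (\<lambda>j. y (Inl j)) p"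
    by (simp add: std_ip_def direct_sum_vec_def)
  also have "(\<Sum>i\<in>Sigma V (\<lambda>u. {..<b u}). ?f (Inr i)) = (\<Sum>v\<in>V. \<Sum>j<b v. ?f (Inr (v, j)))"
    by (subst sum.Sigma) (simp_all add: assms split_beta)
  also have "\<dots> = (\<Sum>v\<in>V. if v = u then std_ip {..<b u} (\<lambda>j. y (Inr (u, j))) q else 0)"
    by (intro sum.cong) (auto simp: std_ip_def direct_sum_vec_def)
  also have "\<dots> = std_ip {..<b u} (\<lambda>j. y (Inr (u, j))) q"
    using assms by simp
  finally show ?thesis .
qed

lemma card_direct_sum_index:
  "finite V \<Longrightarrow> card (direct_sum_index a V b) = a + sum b V"
  by (simp add: direct_sum_index_def card_Plus)

lemma std_ip_zero_left [simp]: "std_ip B (\<lambda>_. 0) y = 0"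
  by (simp add: std_ip_def)

text \<open>The components \<open>w u\<close> lie in different summands, so they do not change the
  products between different vectors of \<open>G\<close>. For totality, a test vector orthogonal to
  all vectors vanishes on the summand of each copy of \<open>H\<close>; then the \<open>w u\<close>
  contribute nothing and \<open>g\<close> tests the rest. The \<open>b u\<close> may differ, as
  intermediate dimensions require.\<close>

lemma corona_is_frame_graph:
  fixes G :: "'v pair_pre_digraph" and H :: "'w pair_pre_digraph"
    and g :: "'v \<Rightarrow> nat \<Rightarrow> 'k::rc_field" and h :: "'v \<Rightarrow> 'w \<Rightarrow> nat \<Rightarrow> 'k"
  assumes "pair_digraph G" "pair_digraph H"
    and nbr: "\<And>x. x \<in> pverts H \<Longrightarrow> \<exists>y. (x, y) \<in> parcs H"
    and g: "gram_rep G {..<a} g"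
    and h: "\<And>u. u \<in> pverts G \<Longrightarrow> gram_rep H {..<b u} (h u)"
  shows "is_frame_graph_in_dim TYPE('k) (a + sum b (pverts G)) (corona G H)"
proof -
  interpret G: pair_digraph G by fact
  interpret H: pair_digraph H by fact
  let ?V = "pverts G" and ?W = "pverts H"
  let ?s = "\<lambda>u. std_ip {..<b u}"
  have "\<exists>w. \<forall>x\<in>?W. ?s u w (h u x) \<noteq> 0" if u: "u \<in> ?V" for u
  proof -
    interpret s: fun_ip "{..<b u}" "?s u :: _ \<Rightarrow> _ \<Rightarrow> 'k" by (rule fun_ip_std_ip) simp
    have "\<exists>w. \<forall>x\<in>h u ` ?W. ?s u w x \<noteq> 0"
    proof (rule s.exists_not_orthogonal)
      show "finite (h u ` ?W)" using H.pair_finite_verts by simp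
    next
      fix z assume "z \<in> h u ` ?W"
      then obtain x where x: "x \<in> ?W" "z = h u x" by blast
      then obtain y where y: "(x, y) \<in> parcs H" using nbr by blast
      then have "?s u z (h u y) \<noteq> 0"
        using gram_rep_adj[OF h[OF u] x(1) H.in_arcsD2[OF y] H.no_loops'[OF y]] x(2) by simp
      then show "?s u z z \<noteq> 0" using s.self_eq_zeroD_left by blast
    qed
    then show ?thesis by (simp only: ball_simps)
  qed
  then obtain w where w: "\<And>u x. u \<in> ?V \<Longrightarrow> x \<in> ?W \<Longrightarrow> ?s u (w u) (h u x) \<noteq> 0"
    by metis
  define c where "c i = (case i of Inl u \<Rightarrow> direct_sum_vec (g u) u (w u)
    | Inr (u, x) \<Rightarrow> direct_sum_vec (\<lambda>_. 0) u (h u x))" for i :: "'v + 'v \<times> 'w"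
  have c: "c (Inl u) = direct_sum_vec (g u) u (w u)" "c (Inr (u, x)) = direct_sum_vec (\<lambda>_. 0) u (h u x)" for u x
    by (simp_all add: c_def)
  have c_apply: "c (Inl u) (Inl j) = g u j" "c (Inr (u, x)) (Inl j) = 0"
    "c (Inl u) (Inr (v, j)) = (if v = u then w u j else 0)"
    "c (Inr (u, x)) (Inr (v, j)) = (if v = u then h u x j else 0)" for u v x j
    by (simp_all add: c direct_sum_vec_def)
  let ?B = "direct_sum_index a ?V b"
  have zero_right: "std_ip B y (\<lambda>_. 0) = (0 :: 'k)" for B :: "nat set" and y
    by (simp add: std_ip_def)
  have ip_y: "std_ip ?B y (c (Inr (u, x))) = ?s u (\<lambda>j. y (Inr (u, j))) (h u x)"
    "std_ip ?B y (c (Inl u)) = std_ip {..<a} (\<lambda>j. y (Inl j)) (g u) + ?s u (\<lambda>j. y (Inr (u, j))) (w u)"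
    if "u \<in> ?V" for u x and y :: "nat + 'v \<times> nat \<Rightarrow> 'k"
    unfolding c std_ip_direct_sum[OF G.pair_finite_verts that] zero_right by simp_all
  have ip_rr: "std_ip ?B (c (Inr (u, x))) (c (Inr (v, y))) = (if u = v then ?s u (h u x) (h u y) else 0)"
    and ip_lr: "std_ip ?B (c (Inl u)) (c (Inr (v, y))) = (if u = v then ?s u (w u) (h u y) else 0)"
    and ip_ll: "u \<noteq> v \<Longrightarrow> std_ip ?B (c (Inl u)) (c (Inl v)) = std_ip {..<a} (g u) (g v)"
    if "v \<in> ?V" for u v x y
    unfolding ip_y[OF that] c_apply by auto
  interpret s: fun_ip ?B "std_ip ?B :: _ \<Rightarrow> _ \<Rightarrow> 'k"
    by (rule fun_ip_std_ip) (simp add: direct_sum_index_def G.pair_finite_verts)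
  have ip_rl: "std_ip ?B (c (Inr (u, x))) (c (Inl v)) \<noteq> 0 \<longleftrightarrow> u = v"
    if "u \<in> ?V" "v \<in> ?V" "x \<in> ?W" for u v x
    using s.eq_zero_sym[of "c (Inr (u, x))" "c (Inl v)"] ip_lr[OF that(1), of v x] w[OF that(1,3)] by auto
  have "gram_rep (corona G H) ?B c"
    unfolding gram_rep_def
  proof (intro conjI ballI impI allI)
    fix i j assume ij: "i \<in> pverts (corona G H)" "j \<in> pverts (corona G H)" "i \<noteq> j"
    have cases: "(\<exists>u\<in>?V. i = Inl u) \<or> (\<exists>u\<in>?V. \<exists>x\<in>?W. i = Inr (u, x))"
      "(\<exists>u\<in>?V. j = Inl u) \<or> (\<exists>u\<in>?V. \<exists>x\<in>?W. j = Inr (u, x))"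
      using ij(1,2) by (auto simp: pverts_corona)
    then consider
        (ll) u v where "u \<in> ?V" "v \<in> ?V" "i = Inl u" "j = Inl v"
      | (lr) u v y where "u \<in> ?V" "v \<in> ?V" "y \<in> ?W" "i = Inl u" "j = Inr (v, y)"
      | (rl) u v x where "u \<in> ?V" "v \<in> ?V" "x \<in> ?W" "i = Inr (u, x)" "j = Inl v"
      | (rr) u v x y where "u \<in> ?V" "v \<in> ?V" "x \<in> ?W" "y \<in> ?W" "i = Inr (u, x)" "j = Inr (v, y)"
      by blast
    then show "(i, j) \<in> parcs (corona G H) \<longleftrightarrow> std_ip ?B (c i) (c j) \<noteq> 0"
    proof cases
      case ll
      with ij(3) have "u \<noteq> v" by simp
      then show ?thesis
        using gram_rep_adj[OF g ll(1,2)] by (simp add: ll parcs_corona_iff ip_ll)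
    next
      case lr
      then show ?thesis using w[OF lr(1,3)] by (auto simp: parcs_corona_iff ip_lr)
    next
      case rl
      then show ?thesis using ip_rl[OF rl(1,2,3)] by (simp add: parcs_corona_iff)
    next
      case rr
      have "x \<noteq> y" if "u = v" using that ij(3) rr by auto
      then show ?thesis
        using gram_rep_adj[OF h[OF rr(1)] rr(3,4)] rr(1,2) by (auto simp: rr(5,6) parcs_corona_iff ip_rr)
    qed
  next
    fix y i assume y: "\<forall>i\<in>pverts (corona G H). std_ip ?B y (c i) = 0" and i: "i \<in> ?B"
    have r0: "y (Inr (u, j)) = 0" if u: "u \<in> ?V" and j: "j \<in> {..<b u}" for u j
    proof (rule gram_rep_total[OF h[OF u] _ j])
      fix x assume "x \<in> ?W"
      then have "std_ip ?B y (c (Inr (u, x))) = 0" using y u by (simp add: pverts_corona)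
      then show "?s u (\<lambda>j. y (Inr (u, j))) (h u x) = 0" unfolding ip_y(1)[OF u] .
    qed
    have l0: "y (Inl j) = 0" if j: "j \<in> {..<a}" for j
    proof (rule gram_rep_total[OF g _ j])
      fix u assume u: "u \<in> ?V"
      have "std_ip ?B y (c (Inl u)) = 0" using y u by (simp add: pverts_corona)
      moreover have "?s u (\<lambda>j. y (Inr (u, j))) (w u) = 0"
        unfolding std_ip_def by (intro sum.neutral ballI) (simp add: r0[OF u])
      ultimately show "std_ip {..<a} (\<lambda>j. y (Inl j)) (g u) = 0" unfolding ip_y(2)[OF u] by simp
    qed
    show "y i = 0" using i by (auto simp: direct_sum_index_def l0 r0)
  qed
  from is_frame_graph_if_gram_rep[OF pair_digraph_corona[OF assms(1,2)] s.finite_index this]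
  show ?thesis by (simp add: card_direct_sum_index G.pair_finite_verts)
qed

text \<open>The vectors of different copies of \<open>H\<close> span mutually orthogonal spaces. The components of
  the vectors of \<open>G\<close> orthogonal to all of these spaces still represent \<open>G\<close>, as the vector of \<open>u\<close>
  is orthogonal to all these spaces but its own.\<close>

lemma corona_frame_dim_split:
  fixes G :: "'v pair_pre_digraph" and H :: "'w pair_pre_digraph"
  assumes "pair_digraph G" "pair_digraph H"
    and arcs: "parcs G \<noteq> {}" "parcs H \<noteq> {}"
    and "is_frame_graph_in_dim TYPE('k::rc_field) d (corona G H)"
  shows "\<exists>a b. is_frame_graph_in_dim TYPE('k) a G \<and> a \<ge> 1 \<and>
    (\<forall>u\<in>pverts G. is_frame_graph_in_dim TYPE('k) (b u) H \<and> b u \<ge> 1) \<and> d = a + sum b (pverts G)"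
proof -
  interpret G: pair_digraph G by fact
  interpret H: pair_digraph H by fact
  interpret C: pair_digraph "corona G H" by (rule pair_digraph_corona) fact+
  let ?V = "pverts G" and ?W = "pverts H"
  obtain \<phi> :: "'v + 'v \<times> 'w \<Rightarrow> nat \<Rightarrow> 'k" where \<phi>: "gram_rep (corona G H) {..<d} \<phi>"
    using gram_rep_if_is_frame_graph(1)[OF C.pair_fin_digraph_axioms assms(5)] by blast
  let ?s = "std_ip {..<d} :: _ \<Rightarrow> _ \<Rightarrow> 'k"
  interpret s: fun_ip "{..<d}" ?s by (rule fun_ip_std_ip) simp
  \<comment> \<open>The last clause encodes that \<open>E\<close> lies in the span of the copy of
    \<open>H\<close> at \<open>u\<close>.\<close>
  define P where "P u E \<longleftrightarrow> s.orthonormal E \<and> (\<forall>x\<in>?W. s.parseval E (\<phi> (Inr (u, x)))) \<and>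
      gram_rep H E (\<lambda>x. ?s (\<phi> (Inr (u, x)))) \<and>
      (\<forall>y. (\<forall>x\<in>?W. ?s y (\<phi> (Inr (u, x))) = 0) \<longrightarrow> (\<forall>e\<in>E. ?s y e = 0))" for u E
  have "\<exists>E. P u E" if u: "u \<in> ?V" for u
  proof -
    have "(x, y) \<in> parcs H \<longleftrightarrow> ?s (\<phi> (Inr (u, x))) (\<phi> (Inr (u, y))) \<noteq>
        (\<Sum>e\<in>{}. ?s (\<phi> (Inr (u, x))) e * conjugate (?s (\<phi> (Inr (u, y))) e))"
      if "x \<in> ?W" "y \<in> ?W" "x \<noteq> y" for x y
      using gram_rep_adj[OF \<phi>, of "Inr (u, x)" "Inr (u, y)"] that u
      by (simp add: pverts_corona parcs_corona_iff)
    from s.gram_rep_orthonormal[OF H.pair_finite_verts s.orthonormal_empty this] obtain E where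
      "s.orthonormal E" "\<forall>x\<in>?W. s.parseval E (\<phi> (Inr (u, x)))"
      "gram_rep H E (\<lambda>x. ?s (\<phi> (Inr (u, x))))"
      "\<forall>y. (\<forall>x\<in>?W. ?s y (\<phi> (Inr (u, x))) = 0) \<longrightarrow> (\<forall>e\<in>E. ?s y e = 0)"
      unfolding Un_empty_left ball_simps by blast
    then show ?thesis unfolding P_def by (intro exI[of _ E] conjI)
  qed
  then obtain E where P: "\<And>u. u \<in> ?V \<Longrightarrow> P u (E u)" by metis
  have E: "\<And>u. u \<in> ?V \<Longrightarrow> s.orthonormal (E u)"
      "\<And>u x. u \<in> ?V \<Longrightarrow> x \<in> ?W \<Longrightarrow> s.parseval (E u) (\<phi> (Inr (u, x)))"
      "\<And>u. u \<in> ?V \<Longrightarrow> gram_rep H (E u) (\<lambda>x. ?s (\<phi> (Inr (u, x))))"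
    and ann: "\<And>u y e. u \<in> ?V \<Longrightarrow> (\<forall>x\<in>?W. ?s y (\<phi> (Inr (u, x))) = 0) \<Longrightarrow> e \<in> E u \<Longrightarrow> ?s y e = 0"
    using P unfolding P_def by simp_all
  have rr: "?s (\<phi> (Inr (u, x))) (\<phi> (Inr (v, y))) = 0"
    if "u \<in> ?V" "v \<in> ?V" "x \<in> ?W" "y \<in> ?W" "u \<noteq> v" for u v x y
    using gram_rep_adj[OF \<phi>, of "Inr (u, x)" "Inr (v, y)"] that by (simp add: pverts_corona parcs_corona_iff)
  have lr: "?s (\<phi> (Inl u)) (\<phi> (Inr (v, y))) = 0"
    if "u \<in> ?V" "v \<in> ?V" "y \<in> ?W" "u \<noteq> v" for u v y
    using gram_rep_adj[OF \<phi>, of "Inl u" "Inr (v, y)"] that by (simp add: pverts_corona parcs_corona_iff)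
  have le: "?s (\<phi> (Inl u)) e = 0" if "u \<in> ?V" "v \<in> ?V" "u \<noteq> v" "e \<in> E v" for u v e
    using lr that by (intro ann[OF that(2) _ that(4)] ballI) simp
  have re: "?s (\<phi> (Inr (u, x))) e = 0" if "u \<in> ?V" "v \<in> ?V" "x \<in> ?W" "u \<noteq> v" "e \<in> E v" for u v x e
    using rr that by (intro ann[OF that(2) _ that(5)] ballI) simp
  \<comment> \<open>Orthogonality passes from the vectors to the basis elements on one side in
    \<open>re\<close>, and here on the other side.\<close>
  have ee: "?s e e' = 0" if "u \<in> ?V" "v \<in> ?V" "u \<noteq> v" "e \<in> E v" "e' \<in> E u" for u v e e'
  proof (rule ann[OF that(1) _ that(5)], rule ballI)
    fix x assume "x \<in> ?W"
    with re[OF that(1,2) _ that(3,4)] show "?s e (\<phi> (Inr (u, x))) = 0"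
      unfolding s.eq_zero_sym[of e] .
  qed
  have fin: "finite (E u)" if "u \<in> ?V" for u
    by (rule s.orthonormal_finite[OF E(1)[OF that]])
  have disj: "E u \<inter> E v = {}" if "u \<in> ?V" "v \<in> ?V" "u \<noteq> v" for u v
  proof (rule ccontr)
    assume "E u \<inter> E v \<noteq> {}"
    then obtain e where e: "e \<in> E u" "e \<in> E v" by blast
    have "?s e e = 1" using E(1)[OF that(1)] e(1) by (simp add: s.orthonormal_def)
    with ee[OF that e(2,1)] show False by simp
  qed
  define E0 where "E0 = (\<Union>u\<in>?V. E u)"
  have E0: "s.orthonormal E0"
    unfolding s.orthonormal_def
  proof (intro conjI ballI)
    show "finite E0" unfolding E0_def using G.pair_finite_verts fin by blast
  next
    fix e e' assume "e \<in> E0" "e' \<in> E0"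
    then obtain u v where uv: "u \<in> ?V" "e \<in> E u" "v \<in> ?V" "e' \<in> E v" unfolding E0_def by blast
    show "?s e e' = (if e = e' then 1 else 0)"
    proof (cases "u = v")
      case True
      with uv E(1)[OF uv(1)] show ?thesis by (simp add: s.orthonormal_def)
    next
      case False
      with disj[OF uv(1,3)] uv have "e \<noteq> e'" by blast
      with ee[OF uv(3,1) _ uv(2,4)] False show ?thesis by simp
    qed
  qed
  have "(u, v) \<in> parcs G \<longleftrightarrow> ?s (\<phi> (Inl u)) (\<phi> (Inl v)) \<noteq>
      (\<Sum>e\<in>E0. ?s (\<phi> (Inl u)) e * conjugate (?s (\<phi> (Inl v)) e))"
    if uv: "u \<in> ?V" "v \<in> ?V" "u \<noteq> v" for u v
  proof -
    \<comment> \<open>An \<open>e\<close> in \<open>E0\<close> belongs to one copy, attached to at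
      most one of \<open>u\<close> and \<open>v\<close>, so one factor of each term
      vanishes.\<close>
    have "(\<Sum>e\<in>E0. ?s (\<phi> (Inl u)) e * conjugate (?s (\<phi> (Inl v)) e)) = 0"
    proof (rule sum.neutral, rule ballI)
      fix e assume "e \<in> E0"
      then obtain w where w: "w \<in> ?V" "e \<in> E w" unfolding E0_def by blast
      have "?s (\<phi> (Inl u)) e = 0 \<or> ?s (\<phi> (Inl v)) e = 0"
      proof (cases "u = w")
        case True
        with uv(3) have "v \<noteq> w" by simp
        from le[OF uv(2) w(1) this w(2)] show ?thesis ..
      next
        case False
        from le[OF uv(1) w(1) this w(2)] show ?thesis ..
      qed
      then show "?s (\<phi> (Inl u)) e * conjugate (?s (\<phi> (Inl v)) e) = 0" by auto
    qed
    then show ?thesis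
      using gram_rep_adj[OF \<phi>, of "Inl u" "Inl v"] uv by (simp add: pverts_corona parcs_corona_iff)
  qed
  from s.gram_rep_orthonormal[OF G.pair_finite_verts E0 this]
  obtain Q where Q: "E0 \<inter> Q = {}" "s.orthonormal (E0 \<union> Q)"
      "\<forall>u\<in>?V. s.parseval (E0 \<union> Q) (\<phi> (Inl u))" "gram_rep G Q (\<lambda>u. ?s (\<phi> (Inl u)))"
    by blast
  \<comment> \<open>The vectors of the corona expand in \<open>E0 \<union> Q\<close> and are total,
    so this is a basis of the whole space and has \<open>d\<close> elements.\<close>
  have "s.parseval (E0 \<union> Q) f" for f
  proof (rule s.parseval_total[OF Q(2), of "\<phi> ` pverts (corona G H)"])
    fix f assume "f \<in> \<phi> ` pverts (corona G H)"
    then consider u where "u \<in> ?V" "f = \<phi> (Inl u)" | u x where "u \<in> ?V" "x \<in> ?W" "f = \<phi> (Inr (u, x))"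
      unfolding pverts_corona by auto
    then show "s.parseval (E0 \<union> Q) f"
    proof cases
      case 1
      with Q(3) show ?thesis by simp
    next
      case 2
      have "E u \<subseteq> E0 \<union> Q" using 2(1) unfolding E0_def by blast
      from s.parseval_mono[OF E(2)[OF 2(1,2)] this Q(2)] show ?thesis unfolding 2(3) .
    qed
  next
    fix x b assume x: "\<And>f. f \<in> \<phi> ` pverts (corona G H) \<Longrightarrow> ?s x f = 0" and b: "b \<in> {..<d}"
    show "x b = 0" by (rule gram_rep_total[OF \<phi> _ b]) (rule x, rule imageI)
  qed
  from s.card_orthonormal_basis[OF Q(2) this] have "card (E0 \<union> Q) = d" by simp
  moreover have "finite E0" "finite Q" using s.orthonormal_finite[OF Q(2)] by simp_all
  ultimately have "d = card Q + card E0" using Q(1) by (simp add: card_Un_disjoint)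
  also have "card E0 = (\<Sum>u\<in>?V. card (E u))"
    unfolding E0_def using fin disj G.pair_finite_verts by (intro card_UN_disjoint) auto
  finally have "d = card Q + (\<Sum>u\<in>?V. card (E u))" .
  moreover have "is_frame_graph_in_dim TYPE('k) (card Q) G" 
    by (rule is_frame_graph_if_gram_rep[OF assms(1) \<open>finite Q\<close> Q(4)])
  moreover have "card Q \<ge> 1"
    using gram_rep_arc_nonempty[OF assms(1) Q(4) arcs(1)] \<open>finite Q\<close> by (simp add: Suc_le_eq card_gt_0_iff)
  moreover have "is_frame_graph_in_dim TYPE('k) (card (E u)) H \<and> card (E u) \<ge> 1" if u: "u \<in> ?V" for u
    using is_frame_graph_if_gram_rep[OF assms(2) fin[OF u] E(3)[OF u]]
      gram_rep_arc_nonempty[OF assms(2) E(3)[OF u] arcs(2)] fin[OF u]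
    by (simp add: Suc_le_eq card_gt_0_iff)
  ultimately show ?thesis
    by (intro exI[of _ "card Q"] exI[of _ "\<lambda>u. card (E u)"] conjI) blast+
qed

section \<open>Distribution of the dimensions\<close>

lemma exists_sum_between:
  fixes p q t :: nat
  assumes "finite V" "p \<le> q" "card V * p \<le> t" "t \<le> card V * q"
  shows "\<exists>b. (\<forall>u\<in>V. p \<le> b u \<and> b u \<le> q) \<and> sum b V = t"
  using assms(1,3,4)
proof (induction V arbitrary: t rule: finite_induct)
  case (insert v V)
  \<comment> \<open>The least share for \<open>v\<close> that leaves at most \<open>q\<close> for
    each remaining vertex; by truncated subtraction it is \<open>p\<close> when \<open>t\<close> is
    at most \<open>card V * q\<close>.\<close>
  define r where "r = max p (t - card V * q)"
  have c: "p + card V * p \<le> t" "t \<le> q + card V * q" using insert by simp_all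
  have cpq: "card V * p \<le> card V * q" using assms(2) by simp
  have r: "p \<le> r" "r \<le> q" "card V * p \<le> t - r" "t - r \<le> card V * q" "r \<le> t"
    unfolding r_def using c cpq assms(2) by (auto simp: max_def) (cases "card V * q \<le> t"; simp)
  obtain b where b: "\<forall>u\<in>V. p \<le> b u \<and> b u \<le> q" "sum b V = t - r"
    using insert.IH[OF r(3,4)] by blast
  have "sum (b(v := r)) V = sum b V" using insert.hyps(2) by (intro sum.cong) auto
  then show ?case
    using b r insert.hyps by (intro exI[of _ "b(v := r)"]) auto
qed simp

lemma corona_frame_dims:
  fixes G :: "'v pair_pre_digraph" and H :: "'w pair_pre_digraph"
  assumes G: "pair_graph G" "Digraph_Component.connected (with_proj G)" "card (pverts G) = n" "n \<ge> 2"
    and H: "pair_graph H" "Digraph_Component.connected (with_proj H)" "card (pverts H) = m" "m \<ge> 2"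
    and dims_G: "\<forall>d\<ge>1. is_frame_graph_in_dim TYPE('k::rc_field) d G \<longleftrightarrow> n' \<le> d \<and> d \<le> n"
    and dims_H: "\<forall>d\<ge>1. is_frame_graph_in_dim TYPE('k) d H \<longleftrightarrow> m' \<le> d \<and> d \<le> m"
    and pos: "n' \<ge> 1" "m' \<ge> 1"
  shows "\<forall>d\<ge>1. is_frame_graph_in_dim TYPE('k) d (corona G H) \<longleftrightarrow> n * m' + n' \<le> d \<and> d \<le> n * m + n"
proof -
  interpret G: pair_graph G by fact
  interpret H: pair_graph H by fact
  interpret C: pair_digraph "corona G H"
    by (rule pair_digraph_corona[OF G.pair_digraph H.pair_digraph])
  have nbr_G: "\<exists>v. (u, v) \<in> parcs G" if "u \<in> pverts G" for u
    using connected_has_neighbour[OF G(1,2)] G(3,4) that by simp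
  have nbr_H: "\<exists>y. (x, y) \<in> parcs H" if "x \<in> pverts H" for x
    using connected_has_neighbour[OF H(1,2)] H(3,4) that by simp
  have "pverts G \<noteq> {}" "pverts H \<noteq> {}" using G(3,4) H(3,4) by auto
  then have arcs: "parcs G \<noteq> {}" "parcs H \<noteq> {}" using nbr_G nbr_H by fast+
  \<comment> \<open>The equivalence \<open>dims_G\<close> would also hold with an empty interval if
    no dimension occurred; the dimension found here excludes this.\<close>
  have n': "n' \<le> n"
  proof -
    obtain d where "d \<ge> 1" "is_frame_graph_in_dim TYPE('k) d G"
      using exists_frame_dim[OF G(1) arcs(1)] by blast
    with dims_G have "n' \<le> d" "d \<le> n" by blast+
    then show ?thesis by simp
  qed
  have m': "m' \<le> m"
  proof -
    obtain d where "d \<ge> 1" "is_frame_graph_in_dim TYPE('k) d H"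
      using exists_frame_dim[OF H(1) arcs(2)] by blast
    with dims_H have "m' \<le> d" "d \<le> m" by blast+
    then show ?thesis by simp
  qed
  show ?thesis
  proof (intro allI impI iffI)
    fix d assume d: "is_frame_graph_in_dim TYPE('k) d (corona G H)"
    have "d \<le> n * m + n"
      using gram_rep_if_is_frame_graph(2)[OF C.pair_fin_digraph_axioms d]
      by (simp add: card_pverts_corona G.pair_finite_verts H.pair_finite_verts G(3) H(3))
    moreover obtain a b where ab: "is_frame_graph_in_dim TYPE('k) a G" "a \<ge> 1" "d = a + sum b (pverts G)"
      "\<And>u. u \<in> pverts G \<Longrightarrow> is_frame_graph_in_dim TYPE('k) (b u) H \<and> b u \<ge> 1"
      using corona_frame_dim_split[OF G.pair_digraph H.pair_digraph arcs d] by blast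
    have "n' \<le> a" using dims_G ab(1,2) by blast
    moreover have "m' \<le> b u" if "u \<in> pverts G" for u using dims_H ab(4)[OF that] by blast
    then have "card (pverts G) * m' \<le> sum b (pverts G)"
      using sum_bounded_below[of "pverts G" m' b] by simp
    ultimately show "n * m' + n' \<le> d \<and> d \<le> n * m + n" using ab(3) G(3) by simp
  next
    fix d assume d: "n * m' + n' \<le> d \<and> d \<le> n * m + n"
    \<comment> \<open>The copies of \<open>H\<close> take as much as possible while
      \<open>n'\<close> dimensions are left for \<open>G\<close>. The rest \<open>d - t\<close> is
      \<open>d - n * m\<close> if all copies are full and \<open>n'\<close> otherwise, so it stays
      between \<open>n'\<close> and \<open>n\<close>.\<close>
    define t where "t = min (n * m) (d - n')"
    have nm: "n * m' \<le> n * m" using m' by simp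
    have t: "n * m' \<le> t" "t \<le> n * m" "n' \<le> d - t" "d - t \<le> n" "t \<le> d"
      unfolding t_def using d nm n' by (auto simp: min_def)
    obtain b where b: "\<And>u. u \<in> pverts G \<Longrightarrow> m' \<le> b u \<and> b u \<le> m" "sum b (pverts G) = t"
      using exists_sum_between[OF G.pair_finite_verts m', of t] t(1,2) G(3) by blast
    have "is_frame_graph_in_dim TYPE('k) (d - t) G" using dims_G t(3,4) pos(1) by simp
    then obtain g :: "'v \<Rightarrow> nat \<Rightarrow> 'k" where g: "gram_rep G {..<d - t} g"
      using gram_rep_if_is_frame_graph(1)[OF G.pair_fin_digraph_axioms] by blast
    have "\<exists>h :: 'w \<Rightarrow> nat \<Rightarrow> 'k. gram_rep H {..<b u} h" if "u \<in> pverts G" for u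
    proof -
      have "b u \<ge> 1" using b(1)[OF that] pos(2) by linarith
      then have "is_frame_graph_in_dim TYPE('k) (b u) H" using dims_H b(1)[OF that] by blast
      from gram_rep_if_is_frame_graph(1)[OF H.pair_fin_digraph_axioms this] show ?thesis .
    qed
    then obtain h :: "'v \<Rightarrow> 'w \<Rightarrow> nat \<Rightarrow> 'k" where h: "\<And>u. u \<in> pverts G \<Longrightarrow> gram_rep H {..<b u} (h u)"
      by metis
    have "is_frame_graph_in_dim TYPE('k) (d - t + sum b (pverts G)) (corona G H)"
      by (rule corona_is_frame_graph[OF G.pair_digraph H.pair_digraph _ g]) (erule nbr_H, erule h)
    then show "is_frame_graph_in_dim TYPE('k) d (corona G H)" using b(2) t(5) by simp
  qed
qed

theorem theorem3p14:
  fixes G :: "'v pair_pre_digraph" and H :: "'w pair_pre_digraph"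
    and n m n' m' :: nat
  assumes "pair_graph G" and "Digraph_Component.connected (with_proj G)"
    and "card (pverts G) = n" and "n \<ge> 2"
    and "pair_graph H" and "Digraph_Component.connected (with_proj H)"
    and "card (pverts H) = m" and "m \<ge> 2"
    and "chordal G \<or> is_cycle_graph G"
    and "chordal H \<or> is_cycle_graph H"
    and "n' \<ge> 1" and "m' \<ge> 1"
    and "just_frame_graph_in_dims G n' n"
    and "just_frame_graph_in_dims H m' m"
  shows "just_frame_graph_in_dims (corona G H) (n * m' + n') (n * m + n)"
  using assms(13,14) unfolding just_frame_graph_in_dims_def
  by (intro conjI corona_frame_dims[OF assms(1-8) _ _ assms(11,12)]) blast+

end
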